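(* Let $c_1,c_2\ge 1$ be integers such that either $c_2<c_1\leq 2c_2$ or $c_1=c_2>1$. Let $G\cong \mathbb{Z}_{n_1}\oplus\cdots\oplus \mathbb{Z}_{n_t}$ be a finite abelian group, where $n_{i+1}\mid n_i$ for $1\leq i \leq t-1$. Then $G$ is $[\mathfrak{N}_{c_1},\mathfrak{N}_{c_2}]$-capable if and only if $t\geq 2$ and $n_1=n_2$.
   Context: $\mathbb{Z}_n$ is the cyclic group of order $n$. For a set of words $V$ defining a variety $\mathfrak V$ and a group $E$, the marginal subgroup $V^*(E)$ is the set of all $a\in E$ such that $v(g_1,\dots,g_{i-1},g_ia,g_{i+1},\dots,g_n)=v(g_1,\dots,g_n)$ for all $v\in V$, all $g_1,\dots,g_n\in E$ and all $1\le i\le n$. A group $G$ is $\mathfrak V$-capable if there is a group $E$ with $G\cong E/V^*(E)$. $\mathfrak{N}_c$ is the variety of nilpotent groups of class at most $c$. $[\mathfrak{N}_{c_1},\mathfrak{N}_{c_2}]$ is the outer commutator variety defined by the single word $[[x_1,\dots,x_{c_1+1}],[y_1,\dots,y_{c_2+1}]]$ (left-normed commutators in distinct variables), i.e. the variety of groups $G$ with $[\gamma_{c_1+1}(G),\gamma_{c_2+1}(G)]=1$, where $\gamma_n(G)$ is the $n$-th term of the lower central series.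
   Formalization: The trivial group presented with t ≤ 1 (the empty sum, or t = 1 and n_1 = 1) is excluded, because it is capable (take E trivial) although t ≥ 2 fails, so the claim as stated is false there. *)

theory Defs
  imports "HOL-Algebra.Algebra"
begin

text \<open>
  Group words in variables of type \<open>'x\<close> are represented by terms; distinct terms may denote
  the same element of the free group, but the value of a word in a group respects this.
  \<open>word_vars v\<close> is the set of variables occurring in \<open>v\<close>.
\<close>

datatype (word_vars: 'x) group_word =
    Var 'x
  | One
  | Inv "'x group_word"
  | Mul "'x group_word" "'x group_word"

primrec word_val :: "('g, 'm) monoid_scheme \<Rightarrow> ('x \<Rightarrow> 'g) \<Rightarrow> 'x group_word \<Rightarrow> 'g" where
  "word_val E g (Var i) = g i"
| "word_val E g One = \<one>\<^bsub>E\<^esub>"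
| "word_val E g (Inv v) = inv\<^bsub>E\<^esub> (word_val E g v)"
| "word_val E g (Mul v w) = word_val E g v \<otimes>\<^bsub>E\<^esub> word_val E g w"

definition marginal_subgroup :: "'x group_word set \<Rightarrow> ('g, 'm) monoid_scheme \<Rightarrow> 'g set" where
  "marginal_subgroup V E =
    {a \<in> carrier E. \<forall>v \<in> V. \<forall>g \<in> UNIV \<rightarrow> carrier E. \<forall>i \<in> word_vars v.
       word_val E (g(i := g i \<otimes>\<^bsub>E\<^esub> a)) v = word_val E g v}"

lemma (in group) word_val_closed:
  "g \<in> UNIV \<rightarrow> carrier G \<Longrightarrow> word_val G g v \<in> carrier G"
  by (induction v) auto

lemma (in group) word_val_hom:
  assumes "h \<in> hom G G" "g \<in> UNIV \<rightarrow> carrier G"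
  shows "h (word_val G g v) = word_val G (h \<circ> g) v"
proof -
  interpret group_hom G G h
    using assms(1) by unfold_locales
  show ?thesis
    using word_val_closed[OF assms(2)] by (induction v) auto
qed

text \<open>The quotient below makes sense: the marginal subgroup is normal.\<close>

lemma (in group) marginal_subgroup_normal: "marginal_subgroup V G \<lhd> G"
proof -
  let ?M = "marginal_subgroup V G"
  have eq: "word_val G (g(i := g i \<otimes> a)) v = word_val G g v"
    if "a \<in> ?M" "v \<in> V" "g \<in> UNIV \<rightarrow> carrier G" "i \<in> word_vars v" for a v g i
    using that unfolding marginal_subgroup_def by blast
  have sub: "subgroup ?M G"
  proof (rule subgroupI)
    show "?M \<subseteq> carrier G"
      by (auto simp: marginal_subgroup_def)
    have "\<one> \<in> ?M"
      by (auto simp: marginal_subgroup_def Pi_iff)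
    then show "?M \<noteq> {}"
      by blast
  next
    fix a assume a: "a \<in> ?M"
    then have ac: "a \<in> carrier G"
      by (simp add: marginal_subgroup_def)
    have "word_val G (g(i := g i \<otimes> inv a)) v = word_val G g v"
      if v: "v \<in> V" and g: "g \<in> UNIV \<rightarrow> carrier G" and i: "i \<in> word_vars v" for v g i
    proof -
      let ?g = "g(i := g i \<otimes> inv a)"
      have gc: "?g \<in> UNIV \<rightarrow> carrier G" and gi: "g i \<in> carrier G"
        using g ac by (auto simp: Pi_iff)
      have "?g(i := ?g i \<otimes> a) = g"
        using gi ac by (auto simp: m_assoc)
      then show ?thesis
        using eq[OF a v gc i] by simp
    qed
    then show "inv a \<in> ?M"
      using ac by (simp add: marginal_subgroup_def)
  next
    fix a b assume a: "a \<in> ?M" and b: "b \<in> ?M"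
    then have ac: "a \<in> carrier G" "b \<in> carrier G"
      by (simp_all add: marginal_subgroup_def)
    have "word_val G (g(i := g i \<otimes> (a \<otimes> b))) v = word_val G g v"
      if v: "v \<in> V" and g: "g \<in> UNIV \<rightarrow> carrier G" and i: "i \<in> word_vars v" for v g i
    proof -
      let ?g = "g(i := g i \<otimes> a)"
      have gc: "?g \<in> UNIV \<rightarrow> carrier G" and gi: "g i \<in> carrier G"
        using g ac by (auto simp: Pi_iff)
      have "?g(i := ?g i \<otimes> b) = g(i := g i \<otimes> (a \<otimes> b))"
        using gi ac by (auto simp: m_assoc)
      then show ?thesis
        using eq[OF b v gc i] eq[OF a v g i] by simp
    qed
    then show "a \<otimes> b \<in> ?M"
      using ac by (simp add: marginal_subgroup_def)
  qed
  have "x \<otimes> a \<otimes> inv x \<in> ?M" if x: "x \<in> carrier G" and a: "a \<in> ?M" for x a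
  proof -
    have ac: "a \<in> carrier G"
      using a by (simp add: marginal_subgroup_def)
    define h where "h = (\<lambda>y. x \<otimes> y \<otimes> inv x)"
    define k where "k = (\<lambda>y. inv x \<otimes> y \<otimes> x)"
    have hk: "h (k y) = y" if "y \<in> carrier G" for y
      using x that by (simp add: h_def k_def m_assoc inv_solve_left')
        (metis inv_closed m_assoc m_closed r_inv l_one r_one)
    have hhom: "h \<in> hom G G"
      using x by (auto simp: hom_def h_def m_assoc inv_solve_left')
        (metis inv_closed m_assoc m_closed l_inv l_one)
    have "word_val G (g(i := g i \<otimes> h a)) v = word_val G g v"
      if v: "v \<in> V" and g: "g \<in> UNIV \<rightarrow> carrier G" and i: "i \<in> word_vars v" for v g i
    proof -
      let ?k = "k \<circ> g"
      have kc: "?k \<in> UNIV \<rightarrow> carrier G"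
        using g x by (auto simp: k_def Pi_iff)
      have kc': "?k(i := ?k i \<otimes> a) \<in> UNIV \<rightarrow> carrier G"
        using kc ac by (auto simp: Pi_iff)
      have gi: "g j \<in> carrier G" for j
        using g by (auto simp: Pi_iff)
      have 1: "h \<circ> ?k = g"
        using hk gi by auto
      have "h (?k i \<otimes> a) = g i \<otimes> h a"
        using hom_mult[OF hhom, of "?k i" a] kc ac hk gi by (auto simp: Pi_iff)
      then have 2: "h \<circ> ?k(i := ?k i \<otimes> a) = g(i := g i \<otimes> h a)"
        using hk gi by auto
      show ?thesis
        using word_val_hom[OF hhom kc, of v] word_val_hom[OF hhom kc', of v]
          eq[OF a v kc i] 1 2 by simp
    qed
    then show ?thesis
      using ac x by (simp add: marginal_subgroup_def h_def)
  qed
  then show ?thesis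
    using sub normal_inv_iff by blast
qed

text \<open>
  HOL cannot quantify over all types, so the type \<open>'e\<close> from which the elements of \<open>E\<close> are
  taken is an explicit parameter. For finite \<open>G\<close> all infinite types \<open>'e\<close> give the same notion:
  if \<open>G \<cong> E / V\<^sup>*(E)\<close>, then representatives of the finitely many cosets, together with the
  entries of one tuple witnessing non-marginality of each nontrivial coset, generate a countable
  subgroup \<open>E'\<close> with \<open>E' / V\<^sup>*(E') \<cong> G\<close>.
\<close>

definition varietal_capable ::
    "'e itself \<Rightarrow> 'x group_word set \<Rightarrow> ('g, 'm) monoid_scheme \<Rightarrow> bool" where
  "varietal_capable _ V G \<longleftrightarrow>
    (\<exists>E :: 'e monoid. group E \<and> G \<cong> E Mod marginal_subgroup V E)"

definition comm_word :: "'x group_word \<Rightarrow> 'x group_word \<Rightarrow> 'x group_word" where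
  "comm_word v w = Mul (Mul (Inv v) (Inv w)) (Mul v w)"

text \<open>
  \<open>nilpotent_word x c\<close> is the left-normed commutator \<open>[x\<^sub>1, \<dots>, x\<^bsub>c+1\<^esub>]\<close> of weight \<open>c + 1\<close>,
  which defines the variety of nilpotent groups of class at most \<open>c\<close>.
\<close>

primrec nilpotent_word :: "(nat \<Rightarrow> 'x) \<Rightarrow> nat \<Rightarrow> 'x group_word" where
  "nilpotent_word x 0 = Var (x 1)"
| "nilpotent_word x (Suc c) = comm_word (nilpotent_word x c) (Var (x (c + 2)))"

text \<open>The two families of variables are kept disjoint as \<open>x\<^sub>i = Inl i\<close> and \<open>y\<^sub>j = Inr j\<close>.\<close>

definition outer_comm_word :: "nat \<Rightarrow> nat \<Rightarrow> (nat + nat) group_word" where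
  "outer_comm_word c1 c2 = comm_word (nilpotent_word Inl c1) (nilpotent_word Inr c2)"

end

(*
  Let w = [[x_1, ..., x_{c1+1}], [y_1, ..., y_{c2+1}]] with c1 >= c2.

  If E / V*(E) is abelian, then every commutator is marginal, so w vanishes as soon as one slot
  is filled with a commutator, and hence w is multiplicative in each slot and depends only on the
  classes modulo V*(E). If all m-th powers of the quotient are powers of the m-th power of one
  element a, then in a value of w with a^m in one slot the exponent m can be moved to the slots
  of x_1 and x_2 and back, which replaces their entries by powers of a; such values are trivial,
  so a^m is marginal. For Z_{n_1} + ... + Z_{n_t} take for a a generator of the first summand
  and m = n_2 (m = 1 if t = 1).

  Conversely, in infinite upper unitriangular matrices the commutator of matrices starting on
  the s-th and r-th diagonals starts on the (s+r)-th, with the Lie bracket as leading term. So on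
  the block of size c1 + c2 + 3 the only entry of w is the corner, a multilinear form in the
  superdiagonals. Superdiagonals p a + q b that follow a fixed word in two letters a, b make this
  form the coefficient of the word in a Lie monomial. For a word with coefficient +-1 in a
  suitable monomial, the form detects p and q modulo any ideal I of the coefficient ring, and the
  marginal quotient of the matrix group modulo I is the group of the pairs (p, q) modulo I.
*)

theory Submission
  imports "HOL-Computational_Algebra.Polynomial" Defs
begin

section \<open>Multiplicativity of the outer commutator word\<close>

text \<open>Bracketed exactly as \<open>comm_word\<close>, so that word values unfold to it without
  associativity.\<close>

definition gcomm :: "('g, 'm) monoid_scheme \<Rightarrow> 'g \<Rightarrow> 'g \<Rightarrow> 'g" where
  "gcomm G a b = inv\<^bsub>G\<^esub> a \<otimes>\<^bsub>G\<^esub> inv\<^bsub>G\<^esub> b \<otimes>\<^bsub>G\<^esub> (a \<otimes>\<^bsub>G\<^esub> b)"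

primrec nil_val :: "('g, 'm) monoid_scheme \<Rightarrow> (nat \<Rightarrow> 'g) \<Rightarrow> nat \<Rightarrow> 'g" where
  "nil_val G f 0 = f 1"
| "nil_val G f (Suc c) = gcomm G (nil_val G f c) (f (c + 2))"

lemma word_val_comm_word [simp]:
  "word_val G g (comm_word v w) = gcomm G (word_val G g v) (word_val G g w)"
  by (simp add: comm_word_def gcomm_def)

lemma word_val_nilpotent_word [simp]:
  "word_val G g (nilpotent_word x c) = nil_val G (g \<circ> x) c"
  by (induction c) auto

lemma word_val_outer_comm_word:
  "word_val G g (outer_comm_word c1 c2) =
     gcomm G (nil_val G (g \<circ> Inl) c1) (nil_val G (g \<circ> Inr) c2)"
  by (simp add: outer_comm_word_def)

lemma word_vars_comm_word [simp]:
  "word_vars (comm_word v w) = word_vars v \<union> word_vars w"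
  by (auto simp: comm_word_def)

lemma word_vars_nilpotent_word: "word_vars (nilpotent_word x c) = x ` {1..c + 1}"
proof (induction c)
  case (Suc c)
  have "{1..Suc c + 1} = insert (c + 2) {1..c + 1}" by auto
  with Suc show ?case by simp
qed simp

lemma word_vars_outer_comm_word:
  "word_vars (outer_comm_word c1 c2) = Inl ` {1..c1 + 1} \<union> Inr ` {1..c2 + 1}"
  by (simp add: outer_comm_word_def word_vars_nilpotent_word)

lemma nil_val_cong:
  "(\<And>j. 1 \<le> j \<Longrightarrow> j \<le> c + 1 \<Longrightarrow> f j = h j) \<Longrightarrow> nil_val G f c = nil_val G h c"
  by (induction c) auto

text \<open>Left-normed commutators nest in their first entry. Hence a value of higher weight is
  also a value of each lower weight.\<close>

lemma nil_val_shift: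
  "nil_val G f (k + c) = nil_val G (\<lambda>j. if j = 1 then nil_val G f k else f (j + k)) c"
  by (induction c) (auto simp: add_ac)

section \<open>Commutator identities\<close>

context group
begin

lemma gcomm_closed [simp]: "a \<in> carrier G \<Longrightarrow> b \<in> carrier G \<Longrightarrow> gcomm G a b \<in> carrier G"
  by (simp add: gcomm_def)

lemma nil_val_closed [simp]: "f \<in> UNIV \<rightarrow> carrier G \<Longrightarrow> nil_val G f c \<in> carrier G"
  by (induction c) (auto simp: Pi_iff)

lemma gcomm_eq_iff:
  assumes [simp]: "a \<in> carrier G" "b \<in> carrier G" "k \<in> carrier G"
  shows "gcomm G a b = k \<longleftrightarrow> a \<otimes> b = b \<otimes> (a \<otimes> k)"
proof -
  have "gcomm G a b = inv (b \<otimes> a) \<otimes> (a \<otimes> b)"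
    by (simp add: gcomm_def inv_mult_group)
  then show ?thesis
    by (metis assms inv_closed inv_solve_left m_assoc m_closed)
qed

lemma mult_gcomm:
  "a \<in> carrier G \<Longrightarrow> b \<in> carrier G \<Longrightarrow> a \<otimes> b = b \<otimes> (a \<otimes> gcomm G a b)"
  using gcomm_eq_iff[of a b "gcomm G a b"] by simp

lemma gcomm_eq_one_iff:
  "a \<in> carrier G \<Longrightarrow> b \<in> carrier G \<Longrightarrow> gcomm G a b = \<one> \<longleftrightarrow> a \<otimes> b = b \<otimes> a"
  using gcomm_eq_iff[of a b \<one>] by simp

lemma gcomm_one [simp]:
  "a \<in> carrier G \<Longrightarrow> gcomm G a \<one> = \<one>" "a \<in> carrier G \<Longrightarrow> gcomm G \<one> a = \<one>"
  by (simp_all add: gcomm_eq_one_iff)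

lemma nil_val_one:
  assumes "f \<in> UNIV \<rightarrow> carrier G" "f i = \<one>" "1 \<le> i" "i \<le> c + 1"
  shows "nil_val G f c = \<one>"
  using assms(4)
proof (induction c)
  case 0
  with assms show ?case by (cases i) auto
next
  case (Suc c)
  have "nil_val G f c \<in> carrier G" "f (c + 2) \<in> carrier G"
    using assms(1) by auto
  then show ?case
    using Suc assms(2) by (cases "i = c + 2") auto
qed

lemma commute_mult:
  assumes [simp]: "a \<in> carrier G" "b \<in> carrier G" "t \<in> carrier G"
    and a: "a \<otimes> t = t \<otimes> a" and b: "b \<otimes> t = t \<otimes> b"
  shows "a \<otimes> b \<otimes> t = t \<otimes> (a \<otimes> b)"
  by (metis assms m_assoc)

lemma commute_inv:
  assumes [simp]: "a \<in> carrier G" "t \<in> carrier G"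
    and a: "a \<otimes> t = t \<otimes> a"
  shows "inv a \<otimes> t = t \<otimes> inv a"
  by (metis a assms(1,2) inv_closed inv_solve_left inv_solve_right m_assoc m_closed)

lemma gcomm_mult_left:
  assumes [simp]: "z \<in> carrier G" "u \<in> carrier G" "u' \<in> carrier G" "t \<in> carrier G"
    and z: "gcomm G z t = \<one>" and k: "gcomm G (gcomm G u t) u' = \<one>"
  shows "gcomm G (z \<otimes> (u \<otimes> u')) t = gcomm G u t \<otimes> gcomm G u' t"
proof -
  let ?k = "gcomm G u t" and ?k' = "gcomm G u' t"
  have "(z \<otimes> (u \<otimes> u')) \<otimes> t = z \<otimes> (u \<otimes> (u' \<otimes> t))"
    by (simp add: m_assoc)
  also have "\<dots> = z \<otimes> ((u \<otimes> t) \<otimes> (u' \<otimes> ?k'))"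
    using mult_gcomm[of u' t] by (simp add: m_assoc)
  also have "\<dots> = z \<otimes> ((t \<otimes> (u \<otimes> ?k)) \<otimes> (u' \<otimes> ?k'))"
    using mult_gcomm[of u t] by simp
  also have "\<dots> = (z \<otimes> t) \<otimes> (u \<otimes> ((?k \<otimes> u') \<otimes> ?k'))"
    by (simp add: m_assoc)
  also have "\<dots> = (t \<otimes> z) \<otimes> (u \<otimes> ((u' \<otimes> ?k) \<otimes> ?k'))"
    using z k by (simp add: gcomm_eq_one_iff)
  also have "\<dots> = t \<otimes> ((z \<otimes> (u \<otimes> u')) \<otimes> (?k \<otimes> ?k'))"
    by (simp add: m_assoc)
  finally show ?thesis
    by (subst gcomm_eq_iff) auto
qed

text \<open>Here \<open>t\<close> moves to the right, and the commutator left behind at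
  \<open>u\<close> has to pass both \<open>u'\<close> and \<open>gcomm G t u'\<close>.\<close>

lemma gcomm_mult_right:
  assumes [simp]: "z \<in> carrier G" "u \<in> carrier G" "u' \<in> carrier G" "t \<in> carrier G"
    and z: "gcomm G z t = \<one>" and k: "gcomm G (gcomm G t u) u' = \<one>"
    and k': "gcomm G (gcomm G t u) (gcomm G t u') = \<one>"
  shows "gcomm G t (z \<otimes> (u \<otimes> u')) = gcomm G t u \<otimes> gcomm G t u'"
proof -
  let ?k = "gcomm G t u" and ?k' = "gcomm G t u'"
  have "t \<otimes> (z \<otimes> (u \<otimes> u')) = z \<otimes> ((t \<otimes> u) \<otimes> u')"
    using z by (simp add: gcomm_eq_one_iff flip: m_assoc)
  also have "\<dots> = z \<otimes> (u \<otimes> (t \<otimes> (?k \<otimes> u')))"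
    using mult_gcomm[of t u] by (simp add: m_assoc)
  also have "\<dots> = z \<otimes> (u \<otimes> ((t \<otimes> u') \<otimes> ?k))"
    using k by (simp add: gcomm_eq_one_iff m_assoc)
  also have "\<dots> = z \<otimes> (u \<otimes> (u' \<otimes> (t \<otimes> (?k' \<otimes> ?k))))"
    using mult_gcomm[of t u'] by (simp add: m_assoc)
  also have "\<dots> = (z \<otimes> (u \<otimes> u')) \<otimes> (t \<otimes> (?k \<otimes> ?k'))"
    using k' by (simp add: gcomm_eq_one_iff m_assoc)
  finally show ?thesis
    by (subst gcomm_eq_iff) auto
qed

end

section \<open>Commutators modulo a normal subgroup\<close>

context group_hom
begin

lemma hom_gcomm:
  "a \<in> carrier G \<Longrightarrow> b \<in> carrier G \<Longrightarrow> h (gcomm G a b) = gcomm H (h a) (h b)"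
  by (simp add: gcomm_def)

lemma hom_gcomm_mult_left:
  assumes [simp]: "z \<in> carrier G" "u \<in> carrier G" "u' \<in> carrier G" "t \<in> carrier G"
    and "h (gcomm G z t) = \<one>\<^bsub>H\<^esub>" "h (gcomm G (gcomm G u t) u') = \<one>\<^bsub>H\<^esub>"
  shows "h (gcomm G (z \<otimes> (u \<otimes> u')) t) = h (gcomm G u t \<otimes> gcomm G u' t)"
  using assms(5,6) by (simp add: hom_gcomm H.gcomm_mult_left)

lemma hom_gcomm_mult_right:
  assumes [simp]: "u \<in> carrier G" "u' \<in> carrier G" "t \<in> carrier G"
    and "\<And>s. s \<in> carrier G \<Longrightarrow> h (gcomm G (gcomm G t u) s) = \<one>\<^bsub>H\<^esub>"
  shows "h (gcomm G t (u \<otimes> u')) = h (gcomm G t u \<otimes> gcomm G t u')"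
  using assms(4)[of u'] assms(4)[of "gcomm G t u'"]
    H.gcomm_mult_right[of "\<one>\<^bsub>H\<^esub>" "h u" "h u'" "h t"]
  by (simp add: hom_gcomm)

text \<open>This is the preimage of the centralizer of the image of \<open>h\<close>. Conjugation by
  \<open>x\<close> does not change \<open>h z\<close>, since \<open>h z\<close> commutes with
  \<open>h x\<close>.\<close>

lemma normal_centralizer_image:
  "{z \<in> carrier G. \<forall>t\<in>carrier G. h (gcomm G z t) = \<one>\<^bsub>H\<^esub>} \<lhd> G"
proof -
  let ?Z = "{z \<in> carrier G. \<forall>t\<in>carrier G. h (gcomm G z t) = \<one>\<^bsub>H\<^esub>}"
  have Z: "?Z = {z \<in> carrier G. \<forall>t\<in>carrier G. h z \<otimes>\<^bsub>H\<^esub> h t = h t \<otimes>\<^bsub>H\<^esub> h z}"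
    by (auto simp: hom_gcomm H.gcomm_eq_one_iff)
  have "subgroup ?Z G"
  proof (rule G.subgroupI)
    show "?Z \<noteq> {}"
      unfolding Z using G.one_closed by force
    fix a assume "a \<in> ?Z"
    then have a: "a \<in> carrier G" "\<And>t. t \<in> carrier G \<Longrightarrow> h a \<otimes>\<^bsub>H\<^esub> h t = h t \<otimes>\<^bsub>H\<^esub> h a"
      unfolding Z by blast+
    have "h (inv a) \<otimes>\<^bsub>H\<^esub> h t = h t \<otimes>\<^bsub>H\<^esub> h (inv a)" if "t \<in> carrier G" for t
      unfolding hom_inv[OF a(1)] using a that by (intro H.commute_inv hom_closed)
    then show "inv a \<in> ?Z"
      using a(1) unfolding Z by blast
    fix b assume "b \<in> ?Z"
    then have b: "b \<in> carrier G" "\<And>t. t \<in> carrier G \<Longrightarrow> h b \<otimes>\<^bsub>H\<^esub> h t = h t \<otimes>\<^bsub>H\<^esub> h b"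
      unfolding Z by blast+
    have "h (a \<otimes> b) \<otimes>\<^bsub>H\<^esub> h t = h t \<otimes>\<^bsub>H\<^esub> h (a \<otimes> b)" if "t \<in> carrier G" for t
      unfolding hom_mult[OF a(1) b(1)] using a b that by (intro H.commute_mult hom_closed)
    then show "a \<otimes> b \<in> ?Z"
      using a(1) b(1) unfolding Z by blast
  qed blast
  moreover have "x \<otimes> z \<otimes> inv x \<in> ?Z" if x: "x \<in> carrier G" and z: "z \<in> ?Z" for x z
  proof -
    have zc: "z \<in> carrier G" "h z \<otimes>\<^bsub>H\<^esub> h x = h x \<otimes>\<^bsub>H\<^esub> h z"
      using x z unfolding Z by auto
    then have "h (x \<otimes> z \<otimes> inv x) = h z \<otimes>\<^bsub>H\<^esub> (h x \<otimes>\<^bsub>H\<^esub> inv\<^bsub>H\<^esub> h x)"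
      using x by (simp add: H.m_assoc del: H.r_inv flip: zc(2))
    then have "h (x \<otimes> z \<otimes> inv x) = h z"
      using x zc by simp
    then show ?thesis
      using x z unfolding Z by (auto simp del: hom_mult)
  qed
  ultimately show ?thesis
    by (simp add: G.normal_inv_iff)
qed

end

context normal
begin

lemma group_hom_proj: "group_hom G (G Mod H) (\<lambda>a. H #> a)"
  using r_coset_hom_Mod factorgroup_is_group is_group
  by (simp add: group_hom_def group_hom_axioms_def)

lemma proj_eq_one_iff: "a \<in> carrier G \<Longrightarrow> H #> a = \<one>\<^bsub>G Mod H\<^esub> \<longleftrightarrow> a \<in> H"
  using rcos_const[of a] rcos_self[of a H] is_subgroup by (auto simp: FactGroup_def)

lemma proj_eqD:
  assumes "a \<in> carrier G" "b \<in> carrier G" "H #> a = H #> b"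
  shows "\<exists>z\<in>H. a = z \<otimes> b"
  using assms rcos_self[of a H] is_subgroup by (auto simp: r_coset_def)

lemma gcomm_mult_left_mod:
  assumes "z \<in> carrier G" "u \<in> carrier G" "u' \<in> carrier G" "t \<in> carrier G"
    and "gcomm G z t \<in> H" "gcomm G (gcomm G u t) u' \<in> H"
  shows "\<exists>\<zeta>\<in>H. gcomm G (z \<otimes> (u \<otimes> u')) t = \<zeta> \<otimes> (gcomm G u t \<otimes> gcomm G u' t)"
  using group_hom.hom_gcomm_mult_left[OF group_hom_proj, of z u u' t] assms
  by (intro proj_eqD) (simp_all add: proj_eq_one_iff del: one_FactGroup)

lemma gcomm_mult_right_mod:
  assumes "u \<in> carrier G" "u' \<in> carrier G" "t \<in> carrier G"
    and "\<And>s. s \<in> carrier G \<Longrightarrow> gcomm G (gcomm G t u) s \<in> H"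
  shows "\<exists>\<zeta>\<in>H. gcomm G t (u \<otimes> u') = \<zeta> \<otimes> (gcomm G t u \<otimes> gcomm G t u')"
  using group_hom.hom_gcomm_mult_right[OF group_hom_proj, of u u' t] assms
  by (intro proj_eqD) (simp_all add: proj_eq_one_iff del: one_FactGroup)

text \<open>The preimage of the centre of the quotient, that is, one step of the upper central
  series above \<open>H\<close>.\<close>

lemma central_mod_normal: "{z \<in> carrier G. \<forall>t\<in>carrier G. gcomm G z t \<in> H} \<lhd> G"
proof -
  have "{z \<in> carrier G. \<forall>t\<in>carrier G. gcomm G z t \<in> H} =
      {z \<in> carrier G. \<forall>t\<in>carrier G. H #> gcomm G z t = \<one>\<^bsub>G Mod H\<^esub>}"
    by (intro Collect_cong conj_cong ball_cong refl) (simp add: proj_eq_one_iff del: one_FactGroup)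
  with group_hom.normal_centralizer_image[OF group_hom_proj] show ?thesis
    by simp
qed

end

text \<open>Induction on the weight, passing from \<open>Z\<close> to the preimage of the centre of \<open>G/Z\<close>.\<close>

lemma (in group) nil_val_mult_mod:
  assumes "Z \<lhd> G" "\<And>f. f \<in> UNIV \<rightarrow> carrier G \<Longrightarrow> nil_val G f (Suc c) \<in> Z"
    and "f \<in> UNIV \<rightarrow> carrier G" "x \<in> carrier G" "y \<in> carrier G" "1 \<le> i" "i \<le> c + 1"
  shows "\<exists>z\<in>Z. nil_val G (f(i := x \<otimes> y)) c =
           z \<otimes> (nil_val G (f(i := x)) c \<otimes> nil_val G (f(i := y)) c)"
  using assms
proof (induction c arbitrary: Z f)
  case 0
  then interpret normal Z G by simp
  from 0 show ?case by (intro bexI[of _ \<one>]) auto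
next
  case (Suc c)
  interpret normal Z G by (rule Suc)
  let ?Z = "{z \<in> carrier G. \<forall>t\<in>carrier G. gcomm G z t \<in> Z}"
  \<comment> \<open>Values of weight c + 2 are central modulo \<open>Z\<close>: a further entry
    \<open>t\<close> in the free slot c + 3 raises the weight to c + 3, where all values lie in
    \<open>Z\<close>.\<close>
  have law: "nil_val G f (Suc c) \<in> ?Z" if "f \<in> UNIV \<rightarrow> carrier G" for f
  proof -
    have "gcomm G (nil_val G f (Suc c)) t \<in> Z" if t: "t \<in> carrier G" for t
    proof -
      have "nil_val G (f(c + 3 := t)) (Suc (Suc c)) \<in> Z"
        using \<open>f \<in> _\<close> t by (intro Suc) auto
      moreover have "nil_val G (f(c + 3 := t)) (Suc c) = nil_val G f (Suc c)"
        by (rule nil_val_cong) auto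
      ultimately show ?thesis by (simp add: numeral_3_eq_3)
    qed
    then show ?thesis using that by (auto simp: Pi_iff)
  qed
  note [simp] = Suc.prems(4,5)
  have fc: "f j \<in> carrier G" for j using Suc.prems(3) by auto
  have upd: "f(i := w) \<in> UNIV \<rightarrow> carrier G" if "w \<in> carrier G" for w
    using fc that by auto
  show ?case
  proof (cases "i = c + 2")
    \<comment> \<open>The last entry occurs only in the outermost commutator.\<close>
    case True
    have "nil_val G (f(i := w)) c = nil_val G f c" for w
      using True by (intro nil_val_cong) auto
    then have eq: "nil_val G (f(i := w)) (Suc c) = gcomm G (nil_val G f c) w" for w
      using True by simp
    have "gcomm G (gcomm G (nil_val G f c) x) s \<in> Z" if "s \<in> carrier G" for s
      using law[OF upd[of x]] that eq[of x] by auto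
    then show ?thesis
      unfolding eq using gcomm_mult_right_mod[of x y "nil_val G f c"] Suc.prems(3) by simp
  next
    case False
    let ?u = "nil_val G (f(i := x)) c" and ?u' = "nil_val G (f(i := y)) c" and ?t = "f (c + 2)"
    \<comment> \<open>The inner error \<open>z\<close> is central modulo \<open>Z\<close>, so the
      outer commutator with \<open>?t\<close> absorbs it.\<close>
    obtain z where z: "z \<in> ?Z" and eq: "nil_val G (f(i := x \<otimes> y)) c = z \<otimes> (?u \<otimes> ?u')"
      using Suc.IH[OF central_mod_normal law Suc.prems(3-6)] False Suc.prems(7) by fastforce
    have "?u' \<in> carrier G" using upd[of y] by simp
    then have "gcomm G (nil_val G (f(i := x)) (Suc c)) ?u' \<in> Z"
      using law[OF upd[OF Suc.prems(4)]] by blast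
    moreover have step: "nil_val G (f(i := w)) (Suc c) = gcomm G (nil_val G (f(i := w)) c) ?t" for w
      using False by simp
    ultimately have "gcomm G (gcomm G ?u ?t) ?u' \<in> Z" by metis
    then show ?thesis
      unfolding step
      using gcomm_mult_left_mod[of z ?u ?u' ?t] z fc eq upd False by simp
  qed
qed

lemma (in group_hom) hom_nil_val:
  "f \<in> UNIV \<rightarrow> carrier G \<Longrightarrow> h (nil_val G f c) = nil_val H (h \<circ> f) c"
  by (induction c) (auto simp: hom_gcomm Pi_iff)

section \<open>Centralizers of commutator values\<close>

context group
begin

text \<open>Equals the centralizer of the (c+1)-st term of the lower central series, because the
  values generate that term.\<close>

definition nil_centralizer :: "nat \<Rightarrow> 'a set" where
  "nil_centralizer c =
     {z \<in> carrier G. \<forall>f \<in> UNIV \<rightarrow> carrier G. gcomm G z (nil_val G f c) = \<one>}"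

lemma conj_group_hom: "x \<in> carrier G \<Longrightarrow> group_hom G G (\<lambda>y. x \<otimes> y \<otimes> inv x)"
  by unfold_locales (auto simp: hom_def m_assoc inv_solve_left)

text \<open>A conjugate of a value is the value at conjugated entries.\<close>

lemma nil_centralizer_normal: "nil_centralizer c \<lhd> G"
proof -
  have Z: "nil_centralizer c = {z \<in> carrier G. \<forall>f \<in> UNIV \<rightarrow> carrier G.
      z \<otimes> nil_val G f c = nil_val G f c \<otimes> z}"
    by (auto simp: nil_centralizer_def gcomm_eq_one_iff)
  have "subgroup (nil_centralizer c) G"
    unfolding Z by (rule subgroupI) (auto intro: commute_mult commute_inv)
  moreover have "x \<otimes> z \<otimes> inv x \<in> nil_centralizer c"
    if x: "x \<in> carrier G" and z: "z \<in> nil_centralizer c" for x z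
  proof -
    have zc: "z \<in> carrier G" using z by (simp add: nil_centralizer_def)
    interpret C: group_hom G G "\<lambda>y. x \<otimes> y \<otimes> inv x" by (rule conj_group_hom[OF x])
    interpret D: group_hom G G "\<lambda>y. inv x \<otimes> y \<otimes> inv (inv x)" by (rule conj_group_hom) (use x in simp)
    have "gcomm G (x \<otimes> z \<otimes> inv x) (nil_val G f c) = \<one>" if f: "f \<in> UNIV \<rightarrow> carrier G" for f
    proof -
      let ?k = "\<lambda>y. inv x \<otimes> y \<otimes> inv (inv x)"
      have kf: "?k \<circ> f \<in> UNIV \<rightarrow> carrier G" using f x by (auto simp: Pi_iff)
      have "(\<lambda>y. x \<otimes> y \<otimes> inv x) \<circ> (?k \<circ> f) = f"
        using f x by (auto simp: Pi_iff fun_eq_iff simp flip: m_assoc) (simp add: m_assoc)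
      then have "nil_val G f c = x \<otimes> nil_val G (?k \<circ> f) c \<otimes> inv x"
        using C.hom_nil_val[OF kf, of c] by simp
      moreover have "gcomm G z (nil_val G (?k \<circ> f) c) = \<one>"
        using z kf by (auto simp: nil_centralizer_def)
      ultimately show ?thesis
        using C.hom_gcomm[OF zc nil_val_closed[OF kf, of c]] C.hom_one by simp
    qed
    then show ?thesis
      using x zc by (simp add: nil_centralizer_def)
  qed
  ultimately show ?thesis by (simp add: normal_inv_iff)
qed

lemma nil_centralizer_antimono:
  assumes "z \<in> nil_centralizer c" "f \<in> UNIV \<rightarrow> carrier G" "c \<le> d"
  shows "gcomm G z (nil_val G f d) = \<one>"
proof -
  obtain k where d: "d = k + c" using assms(3) by (metis add.commute le_Suc_ex)
  have "(\<lambda>j. if j = 1 then nil_val G f k else f (j + k)) \<in> UNIV \<rightarrow> carrier G"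
    using assms(2) by (auto simp: Pi_iff)
  then show ?thesis
    using assms(1) unfolding d nil_val_shift nil_centralizer_def by blast
qed

end

section \<open>The outer commutator word in a group with abelian marginal quotient\<close>

locale abelian_marginal_quotient = group +
  fixes c1 c2 :: nat
  assumes le: "c2 \<le> c1" and pos: "1 \<le> c1"
    and gcomm_in_M: "a \<in> carrier G \<Longrightarrow> b \<in> carrier G \<Longrightarrow>
      gcomm G a b \<in> marginal_subgroup {outer_comm_word c1 c2} G"
begin

abbreviation "M \<equiv> marginal_subgroup {outer_comm_word c1 c2} G"
abbreviation "W g \<equiv> word_val G g (outer_comm_word c1 c2)"
abbreviation "vars \<equiv> word_vars (outer_comm_word c1 c2)"

lemma M_closed: "a \<in> M \<Longrightarrow> a \<in> carrier G"
  by (simp add: marginal_subgroup_def)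

lemma W_one:
  assumes "g \<in> UNIV \<rightarrow> carrier G" "i \<in> vars" "g i = \<one>"
  shows "W g = \<one>"
proof -
  have gc: "g \<circ> Inl \<in> UNIV \<rightarrow> carrier G" "g \<circ> Inr \<in> UNIV \<rightarrow> carrier G"
    using assms(1) by (auto simp: Pi_iff)
  from assms(2) consider j where "i = Inl j" "1 \<le> j" "j \<le> c1 + 1"
    | j where "i = Inr j" "1 \<le> j" "j \<le> c2 + 1"
    by (auto simp: word_vars_outer_comm_word)
  then show ?thesis
  proof cases
    case (1 j)
    then have "nil_val G (g \<circ> Inl) c1 = \<one>"
      using gc assms(3) by (intro nil_val_one[of _ j]) auto
    then show ?thesis using gc by (simp add: word_val_outer_comm_word)
  next
    case (2 j)
    then have "nil_val G (g \<circ> Inr) c2 = \<one>"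
      using gc assms(3) by (intro nil_val_one[of _ j]) auto
    then show ?thesis using gc by (simp add: word_val_outer_comm_word)
  qed
qed

lemma W_M_mult:
  assumes "a \<in> M" "g \<in> UNIV \<rightarrow> carrier G" "i \<in> vars" "x \<in> carrier G"
  shows "W (g(i := x \<otimes> a)) = W (g(i := x))"
proof -
  have "g(i := x) \<in> UNIV \<rightarrow> carrier G" using assms by auto
  then have "W ((g(i := x))(i := (g(i := x)) i \<otimes> a)) = W (g(i := x))"
    using assms(1,3) unfolding marginal_subgroup_def by blast
  then show ?thesis by simp
qed

lemma W_M:
  assumes "g \<in> UNIV \<rightarrow> carrier G" "i \<in> vars" "g i \<in> M"
  shows "W g = \<one>"
proof -
  have "W (g(i := \<one> \<otimes> g i)) = W (g(i := \<one>))"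
    using assms by (intro W_M_mult) auto
  also have "\<dots> = \<one>"
    using assms by (intro W_one[of _ i]) auto
  finally show ?thesis using assms by (simp add: M_closed)
qed

lemma nil_val_Suc_eq:
  "nil_val G f (Suc c) = nil_val G (\<lambda>j. if j = 1 then gcomm G (f 1) (f 2) else f (j + 1)) c"
  using nil_val_shift[of G f 1 c] by (simp add: numeral_2_eq_2 cong: if_cong)

text \<open>The commutator of the first two entries is marginal and can be put into the slot of x_1,
  where it makes the outer commutator word trivial.\<close>

lemma nil_val_Suc_left:
  assumes f: "f \<in> UNIV \<rightarrow> carrier G"
  shows "nil_val G f (Suc c1) \<in> nil_centralizer c2"
proof -
  let ?f = "\<lambda>j. if j = 1 then gcomm G (f 1) (f 2) else f (j + 1)"
  have "gcomm G (nil_val G f (Suc c1)) (nil_val G k c2) = \<one>" if k: "k \<in> UNIV \<rightarrow> carrier G" for k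
  proof -
    have "case_sum ?f k \<in> UNIV \<rightarrow> carrier G"
      using f k by (auto simp: Pi_iff split: sum.split)
    then have "W (case_sum ?f k) = \<one>"
      using f by (intro W_M[of _ "Inl 1"]) (auto simp: word_vars_outer_comm_word gcomm_in_M Pi_iff)
    then show ?thesis
      by (simp add: word_val_outer_comm_word comp_def nil_val_Suc_eq del: nil_val.simps)
  qed
  then show ?thesis
    using f unfolding nil_centralizer_def by (auto simp del: nil_val.simps)
qed

lemma nil_val_Suc_right:
  assumes f: "f \<in> UNIV \<rightarrow> carrier G"
  shows "nil_val G f (Suc c2) \<in> nil_centralizer c1"
proof -
  let ?f = "\<lambda>j. if j = 1 then gcomm G (f 1) (f 2) else f (j + 1)"
  have "gcomm G (nil_val G f (Suc c2)) (nil_val G k c1) = \<one>" if k: "k \<in> UNIV \<rightarrow> carrier G" for k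
  proof -
    have "case_sum k ?f \<in> UNIV \<rightarrow> carrier G"
      using f k by (auto simp: Pi_iff split: sum.split)
    then have "W (case_sum k ?f) = \<one>"
      using f by (intro W_M[of _ "Inr 1"]) (auto simp: word_vars_outer_comm_word gcomm_in_M Pi_iff)
    then have "gcomm G (nil_val G k c1) (nil_val G f (Suc c2)) = \<one>"
      by (simp add: word_val_outer_comm_word comp_def nil_val_Suc_eq del: nil_val.simps)
    then show ?thesis
      using f k by (simp add: gcomm_eq_one_iff del: nil_val.simps)
  qed
  then show ?thesis
    using f unfolding nil_centralizer_def by (auto simp del: nil_val.simps)
qed

lemma gcomm_in_centralizer:
  assumes "f \<in> UNIV \<rightarrow> carrier G" "t \<in> carrier G"
  shows "gcomm G (nil_val G f c1) t \<in> nil_centralizer c2"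
proof -
  have "nil_val G (f(c1 + 2 := t)) (Suc c1) \<in> nil_centralizer c2"
    using assms by (intro nil_val_Suc_left) auto
  moreover have "nil_val G (f(c1 + 2 := t)) c1 = nil_val G f c1"
    by (rule nil_val_cong) auto
  ultimately show ?thesis by simp
qed

text \<open>Each half of the word is multiplicative up to an error that centralizes the values of
  the other half; the outer commutator drops this error.\<close>

lemma W_mult:
  assumes g: "g \<in> UNIV \<rightarrow> carrier G" and i: "i \<in> vars"
    and xy [simp]: "x \<in> carrier G" "y \<in> carrier G"
  shows "W (g(i := x \<otimes> y)) = W (g(i := x)) \<otimes> W (g(i := y))"
proof -
  define f k where "f = g \<circ> Inl" and "k = g \<circ> Inr"
  have fk: "f \<in> UNIV \<rightarrow> carrier G" "k \<in> UNIV \<rightarrow> carrier G"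
    using g by (auto simp: f_def k_def Pi_iff)
  have upd: "p(j := w) \<in> UNIV \<rightarrow> carrier G"
    if "p \<in> UNIV \<rightarrow> carrier G" "w \<in> carrier G" for p :: "nat \<Rightarrow> 'a" and w j
    using that by auto
  from i consider j where "i = Inl j" "1 \<le> j" "j \<le> c1 + 1"
    | j where "i = Inr j" "1 \<le> j" "j \<le> c2 + 1"
    by (auto simp: word_vars_outer_comm_word)
  then show ?thesis
  proof cases
    case (1 j)
    let ?u = "\<lambda>w. nil_val G (f(j := w)) c1" and ?v = "nil_val G k c2"
    have W: "W (g(i := w)) = gcomm G (?u w) ?v" for w
    proof -
      have "(g(i := w)) \<circ> Inl = f(j := w)" "(g(i := w)) \<circ> Inr = k"
        using 1 by (auto simp: f_def k_def)
      then show ?thesis by (simp only: word_val_outer_comm_word)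
    qed
    obtain z where z: "z \<in> nil_centralizer c2" "?u (x \<otimes> y) = z \<otimes> (?u x \<otimes> ?u y)"
      using nil_val_mult_mod[OF nil_centralizer_normal nil_val_Suc_left fk(1) xy 1(2,3)] by blast
    \<comment> \<open>The value \<open>?u y\<close> has weight c1 + 1, so by c2 \<le> c1 it is also
      a value of weight c2 + 1.\<close>
    have "gcomm G (gcomm G (?u x) ?v) (?u y) = \<one>"
      using nil_centralizer_antimono[OF gcomm_in_centralizer[OF upd[OF fk(1) xy(1)]
          nil_val_closed[OF fk(2)]] upd[OF fk(1) xy(2)] le] .
    moreover have "gcomm G z ?v = \<one>" "z \<in> carrier G"
      using z fk by (auto simp: nil_centralizer_def)
    ultimately show ?thesis
      unfolding W z(2) using upd fk by (intro gcomm_mult_left) auto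
  next
    case (2 j)
    let ?v = "\<lambda>w. nil_val G (k(j := w)) c2" and ?u = "nil_val G f c1"
    have W: "W (g(i := w)) = gcomm G ?u (?v w)" for w
    proof -
      have "(g(i := w)) \<circ> Inl = f" "(g(i := w)) \<circ> Inr = k(j := w)"
        using 2 by (auto simp: f_def k_def)
      then show ?thesis by (simp only: word_val_outer_comm_word)
    qed
    obtain z where z: "z \<in> nil_centralizer c1" "?v (x \<otimes> y) = z \<otimes> (?v x \<otimes> ?v y)"
      using nil_val_mult_mod[OF nil_centralizer_normal nil_val_Suc_right fk(2) xy 2(2,3)] by blast
    have C: "gcomm G ?u (?v x) \<in> nil_centralizer c2"
      using gcomm_in_centralizer[OF fk(1)] upd[OF fk(2)] by auto
    \<comment> \<open>With \<open>?v y\<close> as an extra entry, \<open>gcomm G ?u (?v y)\<close>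
      is itself a left-normed value of weight c1 + 2, hence centralized by
      \<open>gcomm G ?u (?v x)\<close>.\<close>
    have "nil_val G (f(c1 + 2 := ?v y)) c1 = ?u"
      by (rule nil_val_cong) auto
    then have "nil_val G (f(c1 + 2 := ?v y)) (Suc c1) = gcomm G ?u (?v y)"
      by simp
    then have "gcomm G (gcomm G ?u (?v x)) (gcomm G ?u (?v y)) = \<one>"
      using nil_centralizer_antimono[OF C upd[OF fk(1)], of "?v y" "Suc c1" "c1 + 2"]
        upd[OF fk(2) xy(2)] le by simp
    moreover have "gcomm G (gcomm G ?u (?v x)) (?v y) = \<one>"
      using nil_centralizer_antimono[OF C upd[OF fk(2) xy(2)]] by simp
    moreover have "gcomm G z ?u = \<one>" "z \<in> carrier G"
      using z fk by (auto simp: nil_centralizer_def)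
    ultimately show ?thesis
      unfolding W z(2) using upd fk by (intro gcomm_mult_right) auto
  qed
qed

lemma W_pow:
  assumes "g \<in> UNIV \<rightarrow> carrier G" "i \<in> vars" "x \<in> carrier G"
  shows "W (g(i := x [^] (m :: nat))) = W (g(i := x)) [^] m"
proof (induction m)
  case 0
  then show ?case using assms by (simp, intro W_one[of _ i]) auto
next
  case (Suc m)
  have "W (g(i := x [^] Suc m)) = W (g(i := x [^] m)) \<otimes> W (g(i := x))"
    unfolding nat_pow_Suc using assms by (intro W_mult) auto
  then show ?case unfolding Suc nat_pow_Suc .
qed

text \<open>By \<open>W_pow\<close> the exponent \<open>m\<close> moves from slot \<open>i\<close>
  to slot \<open>j\<close>, where the m-th power is a power of \<open>a\<close> up to a marginal
  factor, and then back.\<close>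

lemma W_pow_swap:
  fixes k m :: nat
  assumes g: "g \<in> UNIV \<rightarrow> carrier G" and i: "i \<in> vars" and j: "j \<in> vars"
    and a: "a \<in> carrier G" and b: "b \<in> M" and k: "g j [^] m = a [^] (k * m) \<otimes> b"
  shows "W (g(i := a [^] m)) = W (g(j := a [^] k, i := a [^] m))"
proof (cases "i = j")
  case False
  have gj: "g j \<in> carrier G" using g by auto
  have gc: "g(i := a) \<in> UNIV \<rightarrow> carrier G" "g(j := a [^] k) \<in> UNIV \<rightarrow> carrier G"
    using g a by auto
  have triv: "(g(i := a))(j := g j) = g(i := a)" using False by auto
  have "W (g(i := a [^] m)) = W ((g(i := a))(j := g j)) [^] m"
    unfolding triv by (rule W_pow[OF g i a])
  also have "\<dots> = W ((g(i := a))(j := g j [^] m))"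
    using W_pow[OF gc(1) j gj] by simp
  also have "\<dots> = W ((g(i := a))(j := (a [^] k) [^] m))"
    unfolding k using W_M_mult[OF b gc(1) j] a by (simp add: nat_pow_pow)
  also have "\<dots> = W ((g(j := a [^] k))(i := a)) [^] m"
    using W_pow[OF gc(1) j, of "a [^] k"] a False by (simp add: fun_upd_twist)
  also have "\<dots> = W ((g(j := a [^] k))(i := a [^] m))"
    using W_pow[OF gc(2) i a] by simp
  finally show ?thesis .
qed simp

text \<open>Applied to the slots of x_1 and x_2, \<open>W_pow_swap\<close> turns both entries into
  powers of \<open>a\<close>; these commute, so the word is trivial.\<close>

lemma pow_in_M:
  fixes m :: nat
  assumes a: "a \<in> carrier G"
    and pow: "\<And>x. x \<in> carrier G \<Longrightarrow> \<exists>k :: nat. \<exists>c \<in> M. x [^] m = a [^] (k * m) \<otimes> c"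
  shows "a [^] m \<in> M"
proof -
  have "W (g(i := a [^] m)) = \<one>" if g: "g \<in> UNIV \<rightarrow> carrier G" and i: "i \<in> vars" for g i
  proof -
    have vars: "Inl 1 \<in> vars" "Inl 2 \<in> vars"
      using pos by (auto simp: word_vars_outer_comm_word)
    obtain k1 b1 where "b1 \<in> M" "g (Inl 1) [^] m = a [^] (k1 * m) \<otimes> b1" using pow g by blast
    then have eq1: "W (g(i := a [^] m)) = W (g(Inl 1 := a [^] k1, i := a [^] m))"
      using W_pow_swap[OF g i vars(1) a] by blast
    have g1: "g(Inl 1 := a [^] k1) \<in> UNIV \<rightarrow> carrier G" using g a by auto
    obtain k2 b2 where "b2 \<in> M" "(g(Inl 1 := a [^] k1)) (Inl 2) [^] m = a [^] (k2 * m) \<otimes> b2"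
      using pow g1 by blast
    then have eq2: "W (g(Inl 1 := a [^] k1, i := a [^] m)) =
        W (g(Inl 1 := a [^] k1, Inl 2 := a [^] k2, i := a [^] m))"
      using W_pow_swap[OF g1 i vars(2) a] by blast
    define g2 where "g2 = g(Inl 1 := a [^] k1, Inl 2 := a [^] k2, i := a [^] m)"
    have g2: "g2 \<in> UNIV \<rightarrow> carrier G" using g a unfolding g2_def by auto
    \<comment> \<open>If \<open>i\<close> is one of these two slots, its entry is
      \<open>a [^] m\<close>, again a power of \<open>a\<close>.\<close>
    have "\<exists>k :: nat. g2 (Inl 1) = a [^] k" "\<exists>k :: nat. g2 (Inl 2) = a [^] k"
      by (auto simp: g2_def)
    then have comm: "gcomm G (g2 (Inl 1)) (g2 (Inl 2)) = \<one>"
      using a by (auto simp: gcomm_eq_one_iff nat_pow_mult add.commute)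
    obtain d where d: "c1 = Suc d" using pos by (cases c1) auto
    have "nil_val G (g2 \<circ> Inl) c1 = \<one>"
      unfolding d nil_val_Suc_eq
      by (rule nil_val_one[of _ 1]) (use g2 comm in \<open>auto simp: Pi_iff\<close>)
    then have "W g2 = \<one>"
      using g2 by (subst word_val_outer_comm_word) (simp add: Pi_iff)
    then show ?thesis using eq1 eq2 by (simp add: g2_def)
  qed
  then have "W (g(i := g i \<otimes> a [^] m)) = W g"
    if g: "g \<in> UNIV \<rightarrow> carrier G" and i: "i \<in> vars" for g i
    using W_mult[OF g i, of "g i" "a [^] m"] word_val_closed[OF g, of "outer_comm_word c1 c2"] g i a
    by (simp add: Pi_iff)
  then show ?thesis
    using a by (simp add: marginal_subgroup_def)
qed

end

section \<open>Powers that vanish in a capable abelian group\<close>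

lemma capable_pow_eq_one:
  assumes cap: "varietal_capable TYPE('e) {outer_comm_word c1 c2} H"
    and "comm_group H" "c2 \<le> c1" "1 \<le> c1" "b \<in> carrier H"
    and "\<And>x. x \<in> carrier H \<Longrightarrow> \<exists>k :: nat. x [^]\<^bsub>H\<^esub> m = b [^]\<^bsub>H\<^esub> (k * m)"
  shows "b [^]\<^bsub>H\<^esub> (m :: nat) = \<one>\<^bsub>H\<^esub>"
proof -
  let ?w = "{outer_comm_word c1 c2}"
  obtain E :: "'e monoid" where E: "group E" "H \<cong> E Mod marginal_subgroup ?w E"
    using cap unfolding varietal_capable_def by blast
  interpret H: comm_group H by fact
  interpret E: group E by fact
  interpret M: normal "marginal_subgroup ?w E" E by (rule E.marginal_subgroup_normal)
  let ?Q = "E Mod marginal_subgroup ?w E"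
  interpret P: group_hom E ?Q "\<lambda>a. marginal_subgroup ?w E #>\<^bsub>E\<^esub> a" by (rule M.group_hom_proj)
  obtain \<phi> where \<phi>: "\<phi> \<in> iso ?Q H"
    using E(2) H.iso_sym unfolding is_iso_def by blast
  define h where "h = (\<lambda>a. \<phi> (marginal_subgroup ?w E #>\<^bsub>E\<^esub> a))"
  have "group_hom ?Q H \<phi>"
    using \<phi> by (simp add: group_hom_def group_hom_axioms_def iso_def P.H.is_group)
  then interpret \<phi>: group_hom ?Q H \<phi> .
  have inj: "inj_on \<phi> (carrier ?Q)" and surj: "\<phi> ` carrier ?Q = carrier H"
    using \<phi> by (auto simp: iso_def bij_betw_def)
  have "group_hom E H h"
    unfolding h_def by unfold_locales (auto simp: hom_def simp del: mult_FactGroup)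
  then interpret h: group_hom E H h .
  have "h a = \<one>\<^bsub>H\<^esub> \<longleftrightarrow> a \<in> marginal_subgroup ?w E" if a: "a \<in> carrier E" for a
    unfolding h_def using \<phi>.inj_iff_trivial_ker inj a M.proj_eq_one_iff[OF a] P.hom_closed[OF a]
      inj_onD[OF inj, of "marginal_subgroup ?w E #>\<^bsub>E\<^esub> a" "\<one>\<^bsub>?Q\<^esub>"] \<phi>.hom_one P.H.one_closed
    by metis
  then have ker: "a \<in> marginal_subgroup ?w E \<longleftrightarrow> h a = \<one>\<^bsub>H\<^esub>" if "a \<in> carrier E" for a
    using that by blast
  \<comment> \<open>Since \<open>H\<close> is abelian, every commutator lies in the kernel of
    \<open>h\<close>, which is the marginal subgroup.\<close>
  interpret W: abelian_marginal_quotient E c1 c2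
    using assms(3,4)
    by unfold_locales (simp_all add: ker h.hom_gcomm H.gcomm_eq_one_iff H.m_comm)
  have "carrier ?Q = (\<lambda>a. marginal_subgroup ?w E #>\<^bsub>E\<^esub> a) ` carrier E"
    by (auto simp: FactGroup_def RCOSETS_def)
  then have "h ` carrier E = carrier H"
    using surj by (simp add: h_def image_image)
  then obtain a where a: "a \<in> carrier E" "b = h a" using assms(5) by blast
  have "\<exists>k :: nat. \<exists>c \<in> marginal_subgroup ?w E. x [^]\<^bsub>E\<^esub> m = a [^]\<^bsub>E\<^esub> (k * m) \<otimes>\<^bsub>E\<^esub> c"
    if x: "x \<in> carrier E" for x
  proof -
    obtain k :: nat where k: "h x [^]\<^bsub>H\<^esub> m = h a [^]\<^bsub>H\<^esub> (k * m)"
      using assms(6)[of "h x"] x a by auto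
    let ?c = "inv\<^bsub>E\<^esub> (a [^]\<^bsub>E\<^esub> (k * m)) \<otimes>\<^bsub>E\<^esub> x [^]\<^bsub>E\<^esub> m"
    have "h ?c = inv\<^bsub>H\<^esub> h (a [^]\<^bsub>E\<^esub> (k * m)) \<otimes>\<^bsub>H\<^esub> h (x [^]\<^bsub>E\<^esub> m)"
      using x a h.hom_mult h.hom_inv by simp
    also have "\<dots> = \<one>\<^bsub>H\<^esub>"
      using x a k h.hom_nat_pow[of x m] h.hom_nat_pow[of a "k * m"] by simp
    finally have "?c \<in> marginal_subgroup ?w E" using x a by (subst ker) auto
    moreover have "x [^]\<^bsub>E\<^esub> m = a [^]\<^bsub>E\<^esub> (k * m) \<otimes>\<^bsub>E\<^esub> ?c"
      using x a by (simp flip: E.m_assoc)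
    ultimately show ?thesis by blast
  qed
  then have "a [^]\<^bsub>E\<^esub> m \<in> marginal_subgroup ?w E"
    by (rule W.pow_in_M[OF a(1)])
  then show ?thesis
    using a ker[of "a [^]\<^bsub>E\<^esub> m"] h.hom_nat_pow[of a m] by simp
qed

section \<open>Capability from a presentation\<close>

lemma (in group_hom) hom_word_val:
  "g \<in> UNIV \<rightarrow> carrier G \<Longrightarrow> h (word_val G g v) = word_val H (h \<circ> g) v"
proof (induction v)
  case (Mul v w)
  then show ?case using G.word_val_closed[of g] by simp
next
  case (Inv v)
  then show ?case using G.word_val_closed[of g] by simp
qed auto

text \<open>The quotient of \<open>H\<close> by \<open>K\<close> is realised on the type \<open>'e\<close>, where it witnesses capability.\<close>

lemma varietal_capableI:
  fixes H :: "'h monoid" and V :: "'x group_word set" and e :: "'h \<Rightarrow> 'c :: countable"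
  assumes K: "K \<lhd> H" and inf: "infinite (UNIV :: 'e set)"
    and e: "\<And>a b. a \<in> carrier H \<Longrightarrow> b \<in> carrier H \<Longrightarrow> e a = e b \<Longrightarrow> a \<otimes>\<^bsub>H\<^esub> inv\<^bsub>H\<^esub> b \<in> K"
    and G: "group G" and \<psi>: "\<psi> \<in> hom H G" "\<psi> ` carrier H = carrier G"
    and ker: "\<And>a. a \<in> carrier H \<Longrightarrow> \<psi> a = \<one>\<^bsub>G\<^esub> \<longleftrightarrow>
      (\<forall>v\<in>V. \<forall>g\<in>UNIV \<rightarrow> carrier H. \<forall>i\<in>word_vars v.
         word_val H (g(i := g i \<otimes>\<^bsub>H\<^esub> a)) v \<otimes>\<^bsub>H\<^esub> inv\<^bsub>H\<^esub> word_val H g v \<in> K)"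
  shows "varietal_capable TYPE('e) V G"
proof -
  interpret K: normal K H by fact
  interpret \<psi>: group_hom H G \<psi>
    using G \<psi> K.is_group by (simp add: group_hom_def group_hom_axioms_def)
  let ?\<kappa> = "\<lambda>a. K #>\<^bsub>H\<^esub> a"
  have \<kappa>: "?\<kappa> a = ?\<kappa> b \<longleftrightarrow> a \<otimes>\<^bsub>H\<^esub> inv\<^bsub>H\<^esub> b \<in> K" if "a \<in> carrier H" "b \<in> carrier H" for a b
    using that K.rcos_module[OF K.is_group that(2,1)] K.repr_independence[OF _ that(2) K.is_subgroup]
      K.rcos_self[OF that(1) K.is_subgroup]
    by metis
  \<comment> \<open>Elements with equal \<open>e\<close> lie in the same coset, and \<open>e\<close>
    takes countably many values, so the cosets can be enumerated.\<close>
  have "?\<kappa> ` carrier H \<subseteq> range (\<lambda>n. ?\<kappa> (inv_into (carrier H) e (from_nat n)))"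
  proof safe
    fix a assume a: "a \<in> carrier H"
    let ?b = "inv_into (carrier H) e (e a)"
    have "?b \<in> carrier H" "e ?b = e a"
      using a by (auto intro: inv_into_into f_inv_into_f)
    then have "?\<kappa> a = ?\<kappa> ?b" using \<kappa>[OF a] e[OF a] by simp
    also have "\<dots> = ?\<kappa> (inv_into (carrier H) e (from_nat (to_nat (e a))))" by simp
    finally show "?\<kappa> a \<in> range (\<lambda>n. ?\<kappa> (inv_into (carrier H) e (from_nat n)))"
      by (rule range_eqI)
  qed
  then have "countable (?\<kappa> ` carrier H)"
    by (rule countable_subset) simp
  then obtain f1 :: "'h set \<Rightarrow> nat" where f1: "inj_on f1 (?\<kappa> ` carrier H)"
    by (auto simp: countable_def)
  obtain f2 :: "nat \<Rightarrow> 'e" where f2: "inj f2"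
    using infinite_countable_subset[OF inf] by blast
  define h where "h = (\<lambda>a. f2 (f1 (?\<kappa> a)))"
  have h_eq: "h a = h b \<longleftrightarrow> a \<otimes>\<^bsub>H\<^esub> inv\<^bsub>H\<^esub> b \<in> K"
    if "a \<in> carrier H" "b \<in> carrier H" for a b
    unfolding h_def \<kappa>[OF that, symmetric] using that f1 f2 by (auto simp: inj_on_def)
  \<comment> \<open>Injective on cosets, \<open>h\<close> carries the multiplication of the quotient
    over to a subset of \<open>'e\<close>.\<close>
  have wm: "weak_group_morphism h K H"
    by (rule weak_group_morphismsI[OF K]) (rule h_eq)
  let ?E = "image_group h H"
  interpret h: group_hom H ?E h
    by (rule K.weak_group_morphism_group_hom[OF wm])
  have carrier_E: "carrier ?E = h ` carrier H"
    by (rule image_group_carrier)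
  let ?M = "marginal_subgroup V ?E"
  interpret M: normal ?M ?E by (rule h.H.marginal_subgroup_normal)
  have in_M: "h a \<in> ?M \<longleftrightarrow> \<psi> a = \<one>\<^bsub>G\<^esub>" if a: "a \<in> carrier H" for a
  proof -
    have eq: "word_val ?E ((h \<circ> g)(i := (h \<circ> g) i \<otimes>\<^bsub>?E\<^esub> h a)) v = word_val ?E (h \<circ> g) v \<longleftrightarrow>
        word_val H (g(i := g i \<otimes>\<^bsub>H\<^esub> a)) v \<otimes>\<^bsub>H\<^esub> inv\<^bsub>H\<^esub> word_val H g v \<in> K"
      if g: "g \<in> UNIV \<rightarrow> carrier H" for g :: "'x \<Rightarrow> 'h" and v i
    proof -
      have gc: "g(i := g i \<otimes>\<^bsub>H\<^esub> a) \<in> UNIV \<rightarrow> carrier H" using g a by (auto simp: Pi_iff)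
      have "h \<circ> g(i := g i \<otimes>\<^bsub>H\<^esub> a) = (h \<circ> g)(i := (h \<circ> g) i \<otimes>\<^bsub>?E\<^esub> h a)"
        using g a by (auto simp: Pi_iff fun_eq_iff)
      then show ?thesis
        using h.hom_word_val[OF g, of v] h.hom_word_val[OF gc, of v]
          h_eq[OF K.word_val_closed[OF gc] K.word_val_closed[OF g], of v v] by simp
    qed
    have surj: "\<exists>g \<in> UNIV \<rightarrow> carrier H. g' = h \<circ> g" if "g' \<in> UNIV \<rightarrow> carrier ?E" for g' :: "'x \<Rightarrow> 'e"
    proof -
      have "\<forall>i. \<exists>b. b \<in> carrier H \<and> g' i = h b"
        using that by (auto simp: carrier_E Pi_iff image_iff Bex_def)
      then obtain g where "\<And>i. g i \<in> carrier H \<and> g' i = h (g i)" by metis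
      then show ?thesis by (intro bexI[of _ g]) (auto simp: fun_eq_iff)
    qed
    \<comment> \<open>Every assignment in \<open>?E\<close> lifts to \<open>H\<close>, so
      marginality in \<open>?E\<close> can be tested on assignments in \<open>H\<close>.\<close>
    have Pi: "UNIV \<rightarrow> carrier ?E = (\<lambda>g :: 'x \<Rightarrow> 'h. h \<circ> g) ` (UNIV \<rightarrow> carrier H)"
    proof
      show "UNIV \<rightarrow> carrier ?E \<subseteq> (\<lambda>g :: 'x \<Rightarrow> 'h. h \<circ> g) ` (UNIV \<rightarrow> carrier H)"
        using surj by blast
    qed (auto simp: Pi_iff)
    have "h a \<in> ?M \<longleftrightarrow> (\<forall>v\<in>V. \<forall>g\<in>UNIV \<rightarrow> carrier H. \<forall>i\<in>word_vars v.
        word_val ?E ((h \<circ> g)(i := (h \<circ> g) i \<otimes>\<^bsub>?E\<^esub> h a)) v = word_val ?E (h \<circ> g) v)"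
      using a unfolding marginal_subgroup_def Pi ball_simps(9) by simp
    then show ?thesis
      using ker[OF a] by (simp add: eq del: o_apply cong: ball_cong)
  qed
  let ?\<chi> = "\<lambda>a. ?M #>\<^bsub>?E\<^esub> h a"
  interpret P: group_hom ?E "?E Mod ?M" "\<lambda>a. ?M #>\<^bsub>?E\<^esub> a" by (rule M.group_hom_proj)
  have "group_hom H (?E Mod ?M) ?\<chi>"
    using h.hom_closed
    by unfold_locales (auto simp: hom_def M.rcos_sum simp del: mult_FactGroup)
  then interpret \<chi>: group_hom H "?E Mod ?M" ?\<chi> .
  have "?\<chi> ` carrier H = carrier (?E Mod ?M)"
    by (auto simp: FactGroup_def RCOSETS_def carrier_E)
  then have "H Mod kernel H (?E Mod ?M) ?\<chi> \<cong> ?E Mod ?M"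
    by (rule \<chi>.FactGroup_iso)
  \<comment> \<open>By \<open>in_M\<close>, both \<open>G\<close> and the marginal quotient of
    \<open>?E\<close> are \<open>H\<close> modulo the same kernel.\<close>
  moreover have "kernel H (?E Mod ?M) ?\<chi> = kernel H G \<psi>"
    unfolding kernel_def using M.proj_eq_one_iff[OF h.hom_closed] in_M by (auto simp del: one_FactGroup)
  ultimately have "H Mod kernel H G \<psi> \<cong> ?E Mod ?M" by simp
  moreover have "G \<cong> H Mod kernel H G \<psi>"
    by (rule group.iso_sym[OF normal.factorgroup_is_group[OF \<psi>.normal_kernel] \<psi>.FactGroup_iso]) fact
  ultimately have "G \<cong> ?E Mod ?M"
    using iso_trans by blast
  then show ?thesis
    unfolding varietal_capable_def using h.H.is_group by blast
qed

section \<open>Leading diagonals of commutators of unitriangular matrices\<close>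

text \<open>The matrices are infinite, so no size enters; the product stays finite because entry (i,
  j) involves only the indices from i to j.\<close>

definition unitri_group :: "(nat \<Rightarrow> nat \<Rightarrow> 'r :: comm_ring_1) monoid" where
  "unitri_group =
     \<lparr>carrier = {A. \<forall>i j. j \<le> i \<longrightarrow> A i j = (if i = j then 1 else 0)},
      monoid.mult = (\<lambda>A B i j. \<Sum>k = i..j. A i k * B k j),
      one = (\<lambda>i j. if i = j then 1 else 0)\<rparr>"

lemma carrier_unitri: "A \<in> carrier unitri_group \<longleftrightarrow>
    (\<forall>i j. j \<le> i \<longrightarrow> A i j = (if i = j then 1 else 0))"
  by (simp add: unitri_group_def)

lemma mult_unitri: "(A \<otimes>\<^bsub>unitri_group\<^esub> B) i j = (\<Sum>k = i..j. A i k * B k j)"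
  by (simp add: unitri_group_def)

lemma one_unitri: "\<one>\<^bsub>unitri_group\<^esub> i j = (if i = j then 1 else 0)"
  by (simp add: unitri_group_def)

lemma unitri_diag: "A \<in> carrier unitri_group \<Longrightarrow> A i i = 1"
  and unitri_below: "A \<in> carrier unitri_group \<Longrightarrow> j < i \<Longrightarrow> A i j = 0"
  by (simp_all add: carrier_unitri)

text \<open>Solves X A = 1 column by column; the diagonal entry 1 of \<open>A\<close> lets column
  \<open>j\<close> be found from the earlier ones.\<close>

function left_inverse :: "(nat \<Rightarrow> nat \<Rightarrow> 'r :: comm_ring_1) \<Rightarrow> nat \<Rightarrow> nat \<Rightarrow> 'r" where
  "left_inverse A i j =
     (if j \<le> i then (if i = j then 1 else 0) else - (\<Sum>k = i..<j. left_inverse A i k * A k j))"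
  by auto
termination by (relation "measure (\<lambda>(A, i, j). j)") auto

declare left_inverse.simps [simp del]

lemma group_unitri: "group (unitri_group :: (nat \<Rightarrow> nat \<Rightarrow> 'r :: comm_ring_1) monoid)"
proof (rule groupI)
  let ?U = "unitri_group :: (nat \<Rightarrow> nat \<Rightarrow> 'r) monoid"
  fix A assume A: "A \<in> carrier ?U"
  show "\<one>\<^bsub>?U\<^esub> \<otimes>\<^bsub>?U\<^esub> A = A"
    using A by (auto simp: fun_eq_iff mult_unitri one_unitri unitri_below if_distrib[of "\<lambda>x. x * _"] cong: if_cong)
  have "left_inverse A \<in> carrier ?U"
    by (simp add: carrier_unitri left_inverse.simps)
  moreover have "left_inverse A \<otimes>\<^bsub>?U\<^esub> A = \<one>\<^bsub>?U\<^esub>"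
  proof (intro ext)
    fix i j :: nat
    consider "j < i" | "j = i" | "i < j" by linarith
    then show "(left_inverse A \<otimes>\<^bsub>?U\<^esub> A) i j = \<one>\<^bsub>?U\<^esub> i j"
    proof cases
      case 3
      then have "{i..j} = insert j {i..<j}" by auto
      then show ?thesis
        using 3 A by (simp add: mult_unitri one_unitri unitri_diag left_inverse.simps[of A i j])
    qed (use A in \<open>simp_all add: mult_unitri one_unitri unitri_diag left_inverse.simps\<close>)
  qed
  ultimately show "\<exists>B\<in>carrier ?U. B \<otimes>\<^bsub>?U\<^esub> A = \<one>\<^bsub>?U\<^esub>" by blast
  fix B assume B: "B \<in> carrier ?U"
  show "A \<otimes>\<^bsub>?U\<^esub> B \<in> carrier ?U"
    using A B by (simp add: carrier_unitri mult_unitri)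
  fix C
  show "A \<otimes>\<^bsub>?U\<^esub> B \<otimes>\<^bsub>?U\<^esub> C = A \<otimes>\<^bsub>?U\<^esub> (B \<otimes>\<^bsub>?U\<^esub> C)"
  proof (intro ext)
    fix i j
    \<comment> \<open>The zeros of \<open>B\<close> below the diagonal allow both summation ranges
      to be extended to all of \<open>i..j\<close>, where the sums can be swapped.\<close>
    have "(\<Sum>k = i..j. (\<Sum>l = i..k. A i l * B l k) * C k j) =
        (\<Sum>k = i..j. \<Sum>l = i..j. A i l * B l k * C k j)"
      unfolding sum_distrib_right
      by (intro sum.cong refl sum.mono_neutral_left) (auto simp: unitri_below[OF B])
    also have "\<dots> = (\<Sum>l = i..j. \<Sum>k = i..j. A i l * B l k * C k j)"
      by (rule sum.swap)
    also have "\<dots> = (\<Sum>l = i..j. A i l * (\<Sum>k = l..j. B l k * C k j))"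
      unfolding sum_distrib_left mult.assoc
      by (intro sum.cong refl sum.mono_neutral_right) (auto simp: unitri_below[OF B])
    finally show "(A \<otimes>\<^bsub>?U\<^esub> B \<otimes>\<^bsub>?U\<^esub> C) i j = (A \<otimes>\<^bsub>?U\<^esub> (B \<otimes>\<^bsub>?U\<^esub> C)) i j"
      by (simp add: mult_unitri)
  qed
qed (simp add: carrier_unitri one_unitri)

interpretation U: group "unitri_group :: (nat \<Rightarrow> nat \<Rightarrow> 'r :: comm_ring_1) monoid"
  by (rule group_unitri)

text \<open>The main diagonal is exempt: for unitriangular \<open>A\<close> this says that
  \<open>A\<close> minus the identity starts on the s-th diagonal or later.\<close>

definition vanishes_below :: "nat \<Rightarrow> (nat \<Rightarrow> nat \<Rightarrow> 'r :: zero) \<Rightarrow> bool" where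
  "vanishes_below s A \<longleftrightarrow> (\<forall>k l. k < l \<longrightarrow> l < k + s \<longrightarrow> A k l = 0)"

lemma vanishes_belowD: "vanishes_below s A \<Longrightarrow> k < l \<Longrightarrow> l < k + s \<Longrightarrow> A k l = 0"
  by (simp add: vanishes_below_def)

text \<open>An index m strictly between k and l contributes only if m \<ge> k + s and l \<ge> m + r;
  in the given range this forces m = k + s and l = k + s + r.\<close>

lemma mult_unitri_low:
  assumes A: "A \<in> carrier unitri_group" "vanishes_below s A"
    and B: "B \<in> carrier unitri_group" "vanishes_below r B"
    and "1 \<le> s" "1 \<le> r" "k < l" "l \<le> k + (s + r)"
  shows "(A \<otimes>\<^bsub>unitri_group\<^esub> B) k l =
    A k l + B k l + (if l = k + (s + r) then A k (k + s) * B (k + s) l else 0)"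
proof -
  have I: "{k..l} = insert k (insert l {k<..<l})" using assms(7) by auto
  have "(\<Sum>m\<in>{k<..<l}. A k m * B m l) =
      (\<Sum>m\<in>{k<..<l}. if m = k + s then if l = k + (s + r) then A k (k + s) * B (k + s) l else 0 else 0)"
  proof (rule sum.cong)
    fix m assume m: "m \<in> {k<..<l}"
    consider "m < k + s" | "m > k + s" | "m = k + s" by linarith
    then show "A k m * B m l =
        (if m = k + s then if l = k + (s + r) then A k (k + s) * B (k + s) l else 0 else 0)"
      using m assms(8) vanishes_belowD[OF A(2), of k m] vanishes_belowD[OF B(2), of m l]
      by cases auto
  qed simp
  then show ?thesis
    using assms(5-8) unitri_diag[OF A(1)] unitri_diag[OF B(1)]
    by (simp add: mult_unitri I algebra_simps)
qed

text \<open>By [A, B] = 1 + (BA)^(-1) (AB - BA), where the inverse has unit diagonal, the leading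
  part of the commutator is the Lie bracket AB - BA.\<close>

lemma gcomm_unitri:
  fixes A B :: "nat \<Rightarrow> nat \<Rightarrow> 'r :: comm_ring_1"
  assumes A: "A \<in> carrier unitri_group" "vanishes_below s A"
    and B: "B \<in> carrier unitri_group" "vanishes_below r B"
    and sr: "1 \<le> s" "1 \<le> r"
  shows "vanishes_below (s + r) (gcomm unitri_group A B)"
    and "gcomm unitri_group A B k (k + (s + r)) =
      A k (k + s) * B (k + s) (k + (s + r)) - B k (k + r) * A (k + r) (k + (s + r))"
proof -
  let ?U = "unitri_group :: (nat \<Rightarrow> nat \<Rightarrow> 'r) monoid"
  let ?P = "B \<otimes>\<^bsub>?U\<^esub> A" and ?Q = "A \<otimes>\<^bsub>?U\<^esub> B"
  note [simp] = A(1) B(1)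
  let ?D = "\<lambda>k l. ?Q k l - ?P k l"
  have D: "?D k l = (if l = k + (s + r) then
      A k (k + s) * B (k + s) (k + (s + r)) - B k (k + r) * A (k + r) (k + (s + r)) else 0)"
    if "k \<le> l" "l \<le> k + (s + r)" for k l
  proof (cases "k = l")
    case True
    then show ?thesis using sr unitri_diag[of ?P] unitri_diag[of ?Q] by simp
  next
    case False
    then show ?thesis
      using that mult_unitri_low[OF A B sr, of k l] mult_unitri_low[OF B A sr(2,1), of k l]
      by (simp add: add.commute[of r s])
  qed
  have C: "gcomm ?U A B k l = (\<Sum>m = k..l. (inv\<^bsub>?U\<^esub> ?P) k m * ?D m l)" if "k < l" for k l
  proof -
    have "gcomm ?U A B = inv\<^bsub>?U\<^esub> ?P \<otimes>\<^bsub>?U\<^esub> ?Q"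
      by (simp add: gcomm_def U.inv_mult_group)
    then have "gcomm ?U A B k l = (\<Sum>m = k..l. (inv\<^bsub>?U\<^esub> ?P) k m * ?D m l) + (inv\<^bsub>?U\<^esub> ?P \<otimes>\<^bsub>?U\<^esub> ?P) k l"
      by (simp only: mult_unitri[of "inv\<^bsub>?U\<^esub> ?P"] flip: sum.distrib) (simp add: algebra_simps)
    moreover have "inv\<^bsub>?U\<^esub> ?P \<otimes>\<^bsub>?U\<^esub> ?P = \<one>\<^bsub>?U\<^esub>" by (rule U.l_inv) simp
    ultimately show ?thesis using that by (simp add: one_unitri)
  qed
  show "vanishes_below (s + r) (gcomm ?U A B)"
    unfolding vanishes_below_def
  proof (intro allI impI)
    fix k l assume kl: "k < l" "l < k + (s + r)"
    have "?D m l = 0" if "m \<in> {k..l}" for m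
      using D[of m l] that kl by auto
    then show "gcomm ?U A B k l = 0"
      unfolding C[OF kl(1)] by (intro sum.neutral) auto
  qed
  let ?l = "k + (s + r)"
  have kl: "k < ?l" using sr by simp
  have I: "{k..?l} = insert k {k<..?l}" by auto
  have "?D m ?l = 0" if "m \<in> {k<..?l}" for m
    using D[of m ?l] that by auto
  then have "(\<Sum>m\<in>{k<..?l}. (inv\<^bsub>?U\<^esub> ?P) k m * ?D m ?l) = 0"
    by (intro sum.neutral) auto
  moreover have "(inv\<^bsub>?U\<^esub> ?P) k k = 1" by (rule unitri_diag) simp
  ultimately show "gcomm ?U A B k ?l =
      A k (k + s) * B (k + s) (k + (s + r)) - B k (k + r) * A (k + r) (k + (s + r))"
    unfolding C[OF kl] I using D[of k ?l] by simp
qed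

text \<open>The first nonvanishing diagonal of a left-normed commutator, from the superdiagonals
  of its entries.\<close>

primrec nil_lead :: "(nat \<Rightarrow> nat \<Rightarrow> 'r :: comm_ring_1) \<Rightarrow> nat \<Rightarrow> nat \<Rightarrow> 'r" where
  "nil_lead S 0 = S 1"
| "nil_lead S (Suc c) =
     (\<lambda>k. nil_lead S c k * S (c + 2) (k + c + 1) - S (c + 2) k * nil_lead S c (k + 1))"

lemma nil_val_unitri:
  assumes f: "f \<in> UNIV \<rightarrow> carrier unitri_group"
  shows "vanishes_below (c + 1) (nil_val unitri_group f c) \<and>
    (\<forall>k. nil_val unitri_group f c k (k + (c + 1)) = nil_lead (\<lambda>i k. f i k (Suc k)) c k)"
proof (induction c)
  case 0
  show ?case by (simp add: vanishes_below_def)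
next
  case (Suc c)
  have fc: "f (c + 2) \<in> carrier unitri_group" and v: "vanishes_below 1 (f (c + 2))"
    using f by (auto simp: vanishes_below_def)
  have "nil_val unitri_group f c (k + 1) (k + 1 + (c + 1)) = nil_lead (\<lambda>i k. f i k (Suc k)) c (k + 1)" for k
    using Suc by blast
  then show ?case
    using gcomm_unitri[OF U.nil_val_closed[OF f] conjunct1[OF Suc] fc v] Suc by simp
qed

text \<open>The corner is the Lie bracket of the leading diagonals of the two halves; in each
  product the second factor starts at the index where the first ends.\<close>

lemma word_val_unitri:
  assumes g: "g \<in> UNIV \<rightarrow> carrier unitri_group"
  defines "S1 \<equiv> \<lambda>i k. g (Inl i) k (Suc k)" and "S2 \<equiv> \<lambda>i k. g (Inr i) k (Suc k)"
  shows "vanishes_below (c1 + c2 + 2) (word_val unitri_group g (outer_comm_word c1 c2))"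
    and "word_val unitri_group g (outer_comm_word c1 c2) 0 (c1 + c2 + 2) =
      nil_lead S1 c1 0 * nil_lead S2 c2 (c1 + 1) - nil_lead S2 c2 0 * nil_lead S1 c1 (c2 + 1)"
proof -
  have fc: "g \<circ> Inl \<in> UNIV \<rightarrow> carrier unitri_group" "g \<circ> Inr \<in> UNIV \<rightarrow> carrier unitri_group"
    using g by (auto simp: Pi_iff)
  note n1 = nil_val_unitri[OF fc(1), of c1] and n2 = nil_val_unitri[OF fc(2), of c2]
  note g = gcomm_unitri[OF U.nil_val_closed[OF fc(1)] conjunct1[OF n1]
      U.nil_val_closed[OF fc(2)] conjunct1[OF n2]]
  have e: "c1 + 1 + (c2 + 1) = c1 + c2 + 2" by simp
  show "vanishes_below (c1 + c2 + 2) (word_val unitri_group g (outer_comm_word c1 c2))"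
    using g(1) unfolding word_val_outer_comm_word e by simp
  have "nil_val unitri_group (g \<circ> Inl) c1 k (k + (c1 + 1)) = nil_lead S1 c1 k"
    "nil_val unitri_group (g \<circ> Inr) c2 k (k + (c2 + 1)) = nil_lead S2 c2 k" for k
    using n1 n2 by (simp_all add: S1_def S2_def)
  from this(1)[of 0] this(1)[of "c2 + 1"] this(2)[of 0] this(2)[of "c1 + 1"]
  show "word_val unitri_group g (outer_comm_word c1 c2) 0 (c1 + c2 + 2) =
      nil_lead S1 c1 0 * nil_lead S2 c2 (c1 + 1) - nil_lead S2 c2 0 * nil_lead S1 c1 (c2 + 1)"
    using g(2)[of 0] unfolding word_val_outer_comm_word by (simp add: add_ac)
qed

text \<open>A letter pattern \<open>w\<close> (\<open>w k\<close> meaning that the \<open>k\<close>-th letter is \<open>b\<close>) turns the element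
  \<open>p a + q b\<close> of the span of two letters \<open>a\<close>, \<open>b\<close> into a superdiagonal. On such superdiagonals,
  \<open>nil_lead\<close> computes the coefficient of a subword of \<open>w\<close> in a left-normed Lie monomial.\<close>

definition letter_diag :: "(nat \<Rightarrow> bool) \<Rightarrow> 'r \<Rightarrow> 'r \<Rightarrow> nat \<Rightarrow> 'r" where
  "letter_diag w p q k = (if w k then q else p)"

text \<open>The premise \<open>base\<close> says that [x_1, x_2] = r [b, a], and the later entries
  are a. So the value is the coefficient of the subword of \<open>w\<close> starting at
  \<open>k\<close> in r [b, a, ..., a]. Every word in that expansion has exactly one b, and b a ...
  a arises only from the product in the written order.\<close>

lemma nil_lead_word:
  fixes r :: "'r :: comm_ring_1"
  assumes base: "\<And>k. S 1 k * S 2 (k + 1) - S 2 k * S 1 (k + 1) =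
      (if w k \<and> \<not> w (k + 1) then r else if \<not> w k \<and> w (k + 1) then - r else 0)"
    and a: "\<And>j. 3 \<le> j \<Longrightarrow> j \<le> c + 1 \<Longrightarrow> S j = letter_diag w 1 0" and "1 \<le> c"
  shows nil_lead_word_eq: "w k \<Longrightarrow> (\<And>m. m \<in> {1..c} \<Longrightarrow> \<not> w (k + m)) \<Longrightarrow> nil_lead S c k = r"
    and nil_lead_word_zero: "k \<le> i \<Longrightarrow> i < j \<Longrightarrow> j \<le> k + c \<Longrightarrow> w i \<Longrightarrow> w j \<Longrightarrow> nil_lead S c k = 0"
proof -
  have "(w k \<longrightarrow> (\<forall>m\<in>{1..c}. \<not> w (k + m)) \<longrightarrow> nil_lead S c k = r) \<and>
      (\<forall>i j. k \<le> i \<longrightarrow> i < j \<longrightarrow> j \<le> k + c \<longrightarrow> w i \<longrightarrow> w j \<longrightarrow> nil_lead S c k = 0)" for k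
    using \<open>1 \<le> c\<close> a
  proof (induction c arbitrary: k rule: dec_induct)
    case base
    have "w k \<and> w (k + 1)" if "k \<le> i" "i < j" "j \<le> k + 1" "w i" "w j" for i j
    proof -
      have "i = k" "j = k + 1" using that by linarith+
      with that(4,5) show ?thesis by simp
    qed
    moreover have "nil_lead S 1 k =
        (if w k \<and> \<not> w (k + 1) then r else if \<not> w k \<and> w (k + 1) then - r else 0)"
      using assms(1)[of k] by (simp add: numeral_2_eq_2)
    ultimately show ?case by auto
  next
    case (step c)
    have S: "S (c + 2) = letter_diag w 1 0" using step.hyps by (intro step.prems) auto
    have IH: "(w k \<longrightarrow> (\<forall>m\<in>{1..c}. \<not> w (k + m)) \<longrightarrow> nil_lead S c k = r) \<and>
      (\<forall>i j. k \<le> i \<longrightarrow> i < j \<longrightarrow> j \<le> k + c \<longrightarrow> w i \<longrightarrow> w j \<longrightarrow> nil_lead S c k = 0)" for k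
      by (rule step.IH) (auto intro: step.prems)
    \<comment> \<open>Bracketing with a removes a letter a from the end of the subword or, with a
      minus sign, from its start.\<close>
    have eq: "nil_lead S (Suc c) k = (if w (k + c + 1) then 0 else nil_lead S c k) -
        (if w k then 0 else nil_lead S c (k + 1))"
      by (simp only: nil_lead.simps S letter_diag_def) auto
    show ?case
    proof (intro conjI allI impI)
      assume "w k" "\<forall>m\<in>{1..Suc c}. \<not> w (k + m)"
      moreover from this(2) have "\<not> w (k + Suc c)" by (rule bspec) simp
      ultimately show "nil_lead S (Suc c) k = r" using eq IH[of k] by simp
    next
      fix i j assume ij: "k \<le> i" "i < j" "j \<le> k + Suc c" "w i" "w j"
      have "nil_lead S c k = 0" if "\<not> w (k + c + 1)"
      proof -
        have "j \<noteq> k + c + 1" using that ij by auto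
        then have "j \<le> k + c" using ij by simp
        then show ?thesis using IH[of k] ij by blast
      qed
      moreover have "nil_lead S c (k + 1) = 0" if "\<not> w k"
      proof -
        have "i \<noteq> k" using that ij by auto
        then have "k + 1 \<le> i" "j \<le> k + 1 + c" using ij by simp_all
        then show ?thesis using IH[of "k + 1"] ij by blast
      qed
      ultimately show "nil_lead S (Suc c) k = 0" using eq by simp
    qed
  qed
  then show "w k \<Longrightarrow> (\<And>m. m \<in> {1..c} \<Longrightarrow> \<not> w (k + m)) \<Longrightarrow> nil_lead S c k = r"
    and "k \<le> i \<Longrightarrow> i < j \<Longrightarrow> j \<le> k + c \<Longrightarrow> w i \<Longrightarrow> w j \<Longrightarrow> nil_lead S c k = 0"
    by blast+
qed

text \<open>The pattern is the concatenation of a word with coefficient \<open>\<plusminus>1\<close> in a left-normed monomial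
  \<open>v\<close> of weight \<open>c2 + 1\<close> and the word \<open>b a^c1\<close>. For \<open>c1 > c2\<close> the former is \<open>b a^c2\<close> with
  \<open>v = [b, a, \<dots>, a]\<close>; for \<open>c1 = c2\<close> it is \<open>b b a \<dots> a\<close> with \<open>v = [b, a, \<dots>, a, b]\<close>.\<close>

lemma exists_letter_pattern:
  assumes "1 \<le> c2" "c2 < c1 \<or> (c1 = c2 \<and> 1 < c1)"
  obtains w y j where "nil_lead (\<lambda>i. letter_diag w (if y i then 0 else 1) (if y i then 1 else 0)) c2 0
      \<in> {1, - 1 :: 'r :: comm_ring_1}"
    and "w 0" "0 < j" "j \<le> c1" "w j" "w (c2 + 1)" "\<And>m. m \<in> {1..c1} \<Longrightarrow> \<not> w (c2 + 1 + m)"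
proof (cases "c2 < c1")
  case True
  define w where "w k \<longleftrightarrow> k = 0 \<or> k = c2 + 1" for k :: nat
  define y where "y i \<longleftrightarrow> i = 1" for i :: nat
  define S where "S i = (letter_diag w (if y i then 0 else 1) (if y i then 1 else 0) :: nat \<Rightarrow> 'r)" for i
  have "nil_lead S c2 0 = 1"
    by (rule nil_lead_word_eq[where w = w])
      (use assms(1) in \<open>auto simp: S_def y_def w_def letter_diag_def fun_eq_iff\<close>)
  \<comment> \<open>By c2 < c1 the second b, at position c2 + 1, is among the first c1 + 1
    letters.\<close>
  then show ?thesis
    using True by (intro that[of w y "c2 + 1"]) (auto simp: w_def S_def[abs_def])
next
  case False
  then have c: "c1 = c2" "1 < c2" using assms by auto
  then obtain e where e: "c2 = Suc e" "1 \<le> e" by (cases c2) auto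
  define w where "w k \<longleftrightarrow> k = 0 \<or> k = 1 \<or> k = c2 + 1" for k :: nat
  define y where "y i \<longleftrightarrow> i = 1 \<or> i = c2 + 1" for i :: nat
  define S where "S i = (letter_diag w (if y i then 0 else 1) (if y i then 1 else 0) :: nat \<Rightarrow> 'r)" for i
  \<comment> \<open>With v' = [b, a, ..., a] the monomial is v' b - b v'. Only b v' can give the
    word b b a ... a, as this ends in a; so v' is read from position 1.\<close>
  have "nil_lead S e 1 = 1"
    by (rule nil_lead_word_eq[where w = w])
      (use e in \<open>auto simp: S_def y_def w_def letter_diag_def fun_eq_iff\<close>)
  then have "nil_lead S c2 0 = - 1"
    using e by (simp add: S_def y_def w_def letter_diag_def)
  then show ?thesis
    using c by (intro that[of w y 1]) (auto simp: w_def S_def[abs_def])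
qed

section \<open>The matrix group of a letter pattern\<close>

lemma mult_unitri_superdiag:
  "A \<in> carrier unitri_group \<Longrightarrow> B \<in> carrier unitri_group \<Longrightarrow>
    (A \<otimes>\<^bsub>unitri_group\<^esub> B) k (Suc k) = A k (Suc k) + B k (Suc k)"
proof -
  have "{k..Suc k} = {k, Suc k}" by auto
  then show "A \<in> carrier unitri_group \<Longrightarrow> B \<in> carrier unitri_group \<Longrightarrow> ?thesis"
    by (simp add: mult_unitri unitri_diag)
qed

lemma inv_unitri_superdiag:
  assumes "A \<in> carrier unitri_group"
  shows "(inv\<^bsub>unitri_group\<^esub> A) k (Suc k) = - A k (Suc k)"
  using mult_unitri_superdiag[of "inv\<^bsub>unitri_group\<^esub> A" A k] assms
  by (simp add: one_unitri eq_neg_iff_add_eq_0)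

definition letter_matrix :: "(nat \<Rightarrow> bool) \<Rightarrow> 'r \<Rightarrow> 'r \<Rightarrow> nat \<Rightarrow> nat \<Rightarrow> 'r :: comm_ring_1" where
  "letter_matrix w p q i j =
     (if i = j then 1 else if j = Suc i then letter_diag w p q i else 0)"

lemma (in group) word_val_subgroup:
  assumes "subgroup S G" "g \<in> UNIV \<rightarrow> S"
  shows "word_val (G\<lparr>carrier := S\<rparr>) g v = word_val G g v"
proof -
  interpret S: group "G\<lparr>carrier := S\<rparr>" by (rule subgroup_imp_group[OF assms(1)])
  show ?thesis
  proof (induction v)
    case (Inv v)
    have "word_val (G\<lparr>carrier := S\<rparr>) g v \<in> S"
      using S.word_val_closed[of g v] assms(2) by simp
    with Inv show ?case using m_inv_consistent[OF assms(1)] by simp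
  qed simp_all
qed

text \<open>\<open>I\<close> is an ideal and \<open>B\<close> an additive group of pairs containing
  both letters. The second b at \<open>j0\<close> kills [x_1, x_2, a, ..., a] at position 0, the
  pattern b a ... a from position c2 + 1 makes it visible there, and \<open>y\<close> marks the
  entries b of the monomial used for the second half.\<close>

locale letter_group =
  fixes w :: "nat \<Rightarrow> bool" and B :: "('r :: comm_ring_1 \<times> 'r) set" and I :: "'r set"
    and c1 c2 :: nat and y :: "nat \<Rightarrow> bool" and j0 :: nat
  assumes I_zero: "0 \<in> I" and I_diff: "x \<in> I \<Longrightarrow> x' \<in> I \<Longrightarrow> x - x' \<in> I"
    and I_mult: "x \<in> I \<Longrightarrow> r * x \<in> I"
    and B_diff: "(p, q) \<in> B \<Longrightarrow> (p', q') \<in> B \<Longrightarrow> (p - p', q - q') \<in> B"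
    and B_a: "(1, 0) \<in> B" and B_b: "(0, 1) \<in> B"
    and c1: "1 \<le> c1"
    and w: "w 0" "0 < j0" "j0 \<le> c1" "w j0" "w (c2 + 1)" "\<And>m. m \<in> {1..c1} \<Longrightarrow> \<not> w (c2 + 1 + m)"
    and y: "nil_lead (\<lambda>i. letter_diag w (if y i then 0 else 1) (if y i then 1 else 0)) c2 0
      \<in> {1, - 1 :: 'r}"
begin

abbreviation "U \<equiv> unitri_group :: (nat \<Rightarrow> nat \<Rightarrow> 'r) monoid"

definition "HC = {A \<in> carrier U. \<exists>p q. (p, q) \<in> B \<and> (\<forall>k. A k (Suc k) = letter_diag w p q k)}"

abbreviation "H \<equiv> U\<lparr>carrier := HC\<rparr>"

text \<open>Position c2 + 2 carries the letter a and position 0 the letter b, so on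
  \<open>HC\<close> these two entries recover the pair of coefficients.\<close>

definition a_part :: "(nat \<Rightarrow> nat \<Rightarrow> 'r) \<Rightarrow> 'r" where "a_part A = A (c2 + 2) (Suc (c2 + 2))"
definition b_part :: "(nat \<Rightarrow> nat \<Rightarrow> 'r) \<Rightarrow> 'r" where "b_part A = A 0 (Suc 0)"

lemma w_a: "\<not> w (c2 + 2)"
  using w(6)[of 1] c1 by simp

lemma HC_iff: "A \<in> HC \<longleftrightarrow> A \<in> carrier U \<and> (a_part A, b_part A) \<in> B \<and>
    (\<forall>k. A k (Suc k) = letter_diag w (a_part A) (b_part A) k)"
proof
  assume "A \<in> HC"
  then obtain p q where pq: "A \<in> carrier U" "(p, q) \<in> B" "\<And>k. A k (Suc k) = letter_diag w p q k"
    by (auto simp: HC_def)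
  have "a_part A = p" "b_part A = q"
    unfolding a_part_def b_part_def pq(3) by (simp_all only: letter_diag_def w(1) w_a if_True if_False)
  with pq show "A \<in> carrier U \<and> (a_part A, b_part A) \<in> B \<and>
    (\<forall>k. A k (Suc k) = letter_diag w (a_part A) (b_part A) k)" by simp
qed (auto simp: HC_def)

lemma parts_mult:
  assumes "A \<in> carrier U" "A' \<in> carrier U"
  shows "a_part (A \<otimes>\<^bsub>U\<^esub> A') = a_part A + a_part A'" "b_part (A \<otimes>\<^bsub>U\<^esub> A') = b_part A + b_part A'"
  using assms by (simp_all add: a_part_def b_part_def mult_unitri_superdiag)

lemma B_zero: "(0, 0) \<in> B"
  using B_diff[OF B_a B_a] by simp

lemma B_minus: "(p, q) \<in> B \<Longrightarrow> (- p, - q) \<in> B"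
  using B_diff[OF B_zero] by simp

lemma B_plus: "(p, q) \<in> B \<Longrightarrow> (p', q') \<in> B \<Longrightarrow> (p + p', q + q') \<in> B"
  using B_diff[OF _ B_minus] by fastforce

lemma letter_matrix_HC:
  assumes "(p, q) \<in> B"
  shows "letter_matrix w p q \<in> HC"
  unfolding HC_def using assms by (auto simp: carrier_unitri letter_matrix_def)

lemma subgroup_HC: "subgroup HC U"
proof (rule U.subgroupI)
  show "HC \<subseteq> carrier U" by (auto simp: HC_def)
  show "HC \<noteq> {}" using letter_matrix_HC[OF B_a] by blast
  show "inv\<^bsub>U\<^esub> A \<in> HC" if A: "A \<in> HC" for A
  proof -
    obtain p q where "A \<in> carrier U" "(p, q) \<in> B" "\<forall>k. A k (Suc k) = letter_diag w p q k"
      using A unfolding HC_def by blast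
    then have "\<forall>k. (inv\<^bsub>U\<^esub> A) k (Suc k) = letter_diag w (- p) (- q) k"
      by (simp add: inv_unitri_superdiag letter_diag_def)
    moreover have "inv\<^bsub>U\<^esub> A \<in> carrier U" "(- p, - q) \<in> B"
      using \<open>A \<in> carrier U\<close> B_minus[OF \<open>(p, q) \<in> B\<close>] by simp_all
    ultimately show ?thesis unfolding HC_def by blast
  qed
  show "A \<otimes>\<^bsub>U\<^esub> A' \<in> HC" if "A \<in> HC" "A' \<in> HC" for A A'
    using that B_plus unfolding HC_iff
    by (auto simp: parts_mult mult_unitri_superdiag) (auto simp: letter_diag_def)
qed

sublocale H: group H
  by (rule U.subgroup_imp_group[OF subgroup_HC])

lemma HC_U: "A \<in> HC \<Longrightarrow> A \<in> carrier U"
  by (simp add: HC_def)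

section \<open>Reduction modulo the ideal\<close>

lemma I_minus: "x \<in> I \<Longrightarrow> - x \<in> I"
  using I_diff[OF I_zero] by simp

lemma I_plus: "x \<in> I \<Longrightarrow> x' \<in> I \<Longrightarrow> x + x' \<in> I"
  using I_diff[OF _ I_minus] by fastforce

lemma I_sum: "(\<And>k. k \<in> S \<Longrightarrow> f k \<in> I) \<Longrightarrow> sum f S \<in> I"
  by (induction S rule: infinite_finite_induct) (auto simp: I_zero I_plus)

lemma I_mult_diff:
  assumes "x - x' \<in> I" "z - z' \<in> I"
  shows "x * z - x' * z' \<in> I"
proof -
  have "x * z - x' * z' = x * (z - z') + z' * (x - x')" by (simp add: algebra_simps)
  then show ?thesis using I_plus I_mult assms by simp
qed

lemma I_diff_diff:
  assumes "x - x' \<in> I" "z - z' \<in> I"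
  shows "(x - z) - (x' - z') \<in> I"
  using I_diff[OF assms] by (simp add: algebra_simps)

text \<open>Bounding the column suffices, since unitriangular matrices agree on and below the
  diagonal.\<close>

definition cong_block :: "(nat \<Rightarrow> nat \<Rightarrow> 'r) \<Rightarrow> (nat \<Rightarrow> nat \<Rightarrow> 'r) \<Rightarrow> bool" where
  "cong_block A A' \<longleftrightarrow> (\<forall>i j. j \<le> c1 + c2 + 2 \<longrightarrow> A i j - A' i j \<in> I)"

lemma cong_block_mult:
  assumes "cong_block A A'" "cong_block C C'"
  shows "cong_block (A \<otimes>\<^bsub>U\<^esub> C) (A' \<otimes>\<^bsub>U\<^esub> C')"
  unfolding cong_block_def mult_unitri sum_subtractf[symmetric]
  by (intro allI impI I_sum I_mult_diff) (use assms in \<open>auto simp: cong_block_def\<close>)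

lemma cong_block_refl: "cong_block A A"
  by (simp add: cong_block_def I_zero)

definition "K = {A \<in> HC. cong_block A \<one>\<^bsub>U\<^esub>}"

lemma inv_H: "A \<in> HC \<Longrightarrow> inv\<^bsub>H\<^esub> A = inv\<^bsub>U\<^esub> A"
  by (rule U.m_inv_consistent[OF subgroup_HC])

lemma mult_inv_in_K:
  assumes "A \<in> HC" "A' \<in> HC"
  shows "A \<otimes>\<^bsub>H\<^esub> inv\<^bsub>H\<^esub> A' \<in> K \<longleftrightarrow> cong_block A A'"
proof
  have AU: "A \<in> carrier U" "A' \<in> carrier U" using assms by (auto simp: HC_U)
  assume "A \<otimes>\<^bsub>H\<^esub> inv\<^bsub>H\<^esub> A' \<in> K"
  then have "cong_block (A \<otimes>\<^bsub>U\<^esub> inv\<^bsub>U\<^esub> A') \<one>\<^bsub>U\<^esub>"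
    by (simp add: K_def inv_H assms)
  from cong_block_mult[OF this cong_block_refl[of A']] show "cong_block A A'"
    using AU by (simp add: U.m_assoc)
next
  have AU: "A \<in> carrier U" "A' \<in> carrier U" using assms by (auto simp: HC_U)
  assume "cong_block A A'"
  from cong_block_mult[OF this cong_block_refl[of "inv\<^bsub>U\<^esub> A'"]]
  have "cong_block (A \<otimes>\<^bsub>U\<^esub> inv\<^bsub>U\<^esub> A') \<one>\<^bsub>U\<^esub>"
    using AU by simp
  moreover have "A \<otimes>\<^bsub>H\<^esub> inv\<^bsub>H\<^esub> A' \<in> HC"
    using H.m_closed[of A "inv\<^bsub>H\<^esub> A'"] H.inv_closed[of A'] assms by simp
  ultimately show "A \<otimes>\<^bsub>H\<^esub> inv\<^bsub>H\<^esub> A' \<in> K"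
    by (simp add: K_def inv_H assms)
qed

text \<open>\<open>K\<close> is the kernel of the reduction of the block modulo
  \<open>I\<close>.\<close>

lemma K_normal: "K \<lhd> H"
  unfolding H.normal_inv_iff
proof (intro conjI ballI)
  have one: "\<one>\<^bsub>U\<^esub> \<in> HC" using H.one_closed by simp
  show "subgroup K H"
  proof (rule H.subgroupI)
    show "K \<subseteq> carrier H" by (auto simp: K_def)
    have "\<one>\<^bsub>U\<^esub> \<in> K" using one by (simp add: K_def cong_block_refl)
    then show "K \<noteq> {}" by blast
    show "inv\<^bsub>H\<^esub> A \<in> K" if A: "A \<in> K" for A
    proof -
      have AH: "A \<in> HC" "cong_block A \<one>\<^bsub>U\<^esub>" using A by (auto simp: K_def)
      then have "cong_block \<one>\<^bsub>U\<^esub> A"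
        unfolding cong_block_def using I_minus by (metis minus_diff_eq)
      then show ?thesis
        using mult_inv_in_K[OF one AH(1)] H.inv_closed[of A] AH(1) H.l_one[of "inv\<^bsub>H\<^esub> A"] by simp
    qed
    show "A \<otimes>\<^bsub>H\<^esub> A' \<in> K" if "A \<in> K" "A' \<in> K" for A A'
      using that cong_block_mult[of A "\<one>\<^bsub>U\<^esub>" A' "\<one>\<^bsub>U\<^esub>"] H.m_closed[of A A']
      by (simp add: K_def)
  qed
  show "C \<otimes>\<^bsub>H\<^esub> A \<otimes>\<^bsub>H\<^esub> inv\<^bsub>H\<^esub> C \<in> K" if "C \<in> carrier H" "A \<in> K" for C A
    using that cong_block_mult[OF cong_block_refl[of C], of A "\<one>\<^bsub>U\<^esub>"] H.m_closed[of C A] HC_U[of C]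
    by (subst mult_inv_in_K) (auto simp: K_def)
qed

section \<open>Values of the word on the matrix group\<close>

abbreviation "W g \<equiv> word_val U g (outer_comm_word c1 c2)"

lemma cong_block_word:
  assumes g: "g \<in> UNIV \<rightarrow> carrier U" "g' \<in> UNIV \<rightarrow> carrier U"
  shows "cong_block (W g) (W g') \<longleftrightarrow> W g 0 (c1 + c2 + 2) - W g' 0 (c1 + c2 + 2) \<in> I"
proof
  assume *: "W g 0 (c1 + c2 + 2) - W g' 0 (c1 + c2 + 2) \<in> I"
  have "W g i j - W g' i j \<in> I" if j: "j \<le> c1 + c2 + 2" for i j
  proof -
    have WU: "W g \<in> carrier U" "W g' \<in> carrier U"
      using g by (auto intro: U.word_val_closed)
    consider "j \<le> i" | "i < j" "j < i + (c1 + c2 + 2)" | "i = 0" "j = c1 + c2 + 2"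
      using j by linarith
    then show ?thesis
    proof cases
      case 1
      then show ?thesis using WU by (simp add: carrier_unitri I_zero)
    next
      case 2
      then show ?thesis
        using vanishes_belowD[OF word_val_unitri(1)[OF g(1)]] vanishes_belowD[OF word_val_unitri(1)[OF g(2)]]
          I_zero by simp
    qed (use * in simp)
  qed
  then show "cong_block (W g) (W g')" by (simp add: cong_block_def)
qed (simp add: cong_block_def)

lemma nil_lead_cong_I:
  assumes "\<And>i k. S i k - S' i k \<in> I"
  shows "nil_lead S c k - nil_lead S' c k \<in> I"
proof (induction c arbitrary: k)
  case (Suc c)
  show ?case
    unfolding nil_lead.simps by (intro I_diff_diff I_mult_diff Suc assms)
qed (simp add: assms)

text \<open>The corner entry is a polynomial in the superdiagonal entries, so it respects congruence
  modulo an ideal.\<close>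

lemma word_cong:
  assumes "g \<in> UNIV \<rightarrow> carrier U" "g' \<in> UNIV \<rightarrow> carrier U"
    and "\<And>i k. g i k (Suc k) - g' i k (Suc k) \<in> I"
  shows "cong_block (W g) (W g')"
  unfolding cong_block_word[OF assms(1,2)] word_val_unitri(2)[OF assms(1)]
    word_val_unitri(2)[OF assms(2)]
  by (intro I_diff_diff I_mult_diff nil_lead_cong_I assms(3))

text \<open>The slots of x_1 and x_2 are left for testing; the other x_i are a, and the y_j spell
  the monomial selected by \<open>y\<close>.\<close>

definition letter_assignment ::
    "(nat \<Rightarrow> nat \<Rightarrow> 'r) \<Rightarrow> (nat \<Rightarrow> nat \<Rightarrow> 'r) \<Rightarrow> nat + nat \<Rightarrow> nat \<Rightarrow> nat \<Rightarrow> 'r" where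
  "letter_assignment A A' = case_sum
     (\<lambda>i. if i = 1 then A else if i = 2 then A' else letter_matrix w 1 0)
     (\<lambda>i. letter_matrix w (if y i then 0 else 1) (if y i then 1 else 0))"

lemma letter_assignment_closed:
  "A \<in> HC \<Longrightarrow> A' \<in> HC \<Longrightarrow> letter_assignment A A' \<in> UNIV \<rightarrow> HC"
  using B_a B_b by (auto simp: letter_assignment_def letter_matrix_HC split: sum.split)

text \<open>In the corner the term with the first half at position 0 vanishes because of the two b
  at 0 and \<open>j0\<close>. In the other term the second half contributes 1 or -1, and the first
  half the determinant \<open>r\<close> of the two coefficient pairs.\<close>

lemma word_letter_assignment:
  assumes A: "A \<in> HC" "A' \<in> HC"
    and r: "r = b_part A * a_part A' - a_part A * b_part A'"
  shows "W (letter_assignment A A') 0 (c1 + c2 + 2) \<in> {r, - r}"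
proof -
  let ?g = "letter_assignment A A'"
  have g: "?g \<in> UNIV \<rightarrow> carrier U"
    using letter_assignment_closed[OF A] HC_U by (auto simp: Pi_iff)
  let ?S = "\<lambda>i k. ?g (Inl i) k (Suc k)" and ?S' = "\<lambda>i k. ?g (Inr i) k (Suc k)"
  have S': "?S' = (\<lambda>i. letter_diag w (if y i then 0 else 1) (if y i then 1 else 0))"
    by (auto simp: fun_eq_iff letter_assignment_def letter_matrix_def)
  have d: "A k (Suc k) = letter_diag w (a_part A) (b_part A) k"
    "A' k (Suc k) = letter_diag w (a_part A') (b_part A') k" for k
    using A unfolding HC_iff by blast+
  have base: "?S 1 k * ?S 2 (k + 1) - ?S 2 k * ?S 1 (k + 1) =
      (if w k \<and> \<not> w (k + 1) then r else if \<not> w k \<and> w (k + 1) then - r else 0)" for k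
    by (simp add: letter_assignment_def d r) (simp add: letter_diag_def algebra_simps)
  have a: "?S j = letter_diag w 1 0" if "3 \<le> j" for j
    using that by (auto simp: fun_eq_iff letter_assignment_def letter_matrix_def)
  have "nil_lead ?S c1 (c2 + 1) = r"
    by (rule nil_lead_word_eq[where w = w and S = ?S]) (use base a c1 w in auto)
  moreover have "nil_lead ?S c1 0 = 0"
    by (rule nil_lead_word_zero[where w = w and i = 0 and j = j0 and S = ?S])
      (use base a c1 w in auto)
  ultimately show ?thesis
    unfolding word_val_unitri(2)[OF g] using y unfolding S' by auto
qed

lemma parts_in_I_iff:
  assumes A: "A \<in> HC"
  shows "a_part A \<in> I \<and> b_part A \<in> I \<longleftrightarrow>
    (\<forall>g \<in> UNIV \<rightarrow> HC. \<forall>i \<in> word_vars (outer_comm_word c1 c2).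
       cong_block (W (g(i := g i \<otimes>\<^bsub>U\<^esub> A))) (W g))" (is "_ \<longleftrightarrow> ?R")
proof
  assume *: "a_part A \<in> I \<and> b_part A \<in> I"
  show ?R
  proof (intro ballI)
    fix g :: "nat + nat \<Rightarrow> nat \<Rightarrow> nat \<Rightarrow> 'r" and i
    assume g: "g \<in> UNIV \<rightarrow> HC"
    have gU: "g j \<in> carrier U" for j using g HC_U by auto
    have AU: "A \<in> carrier U" using A by (rule HC_U)
    have "A k (Suc k) = letter_diag w (a_part A) (b_part A) k" for k
      using A unfolding HC_iff by blast
    then have "A k (Suc k) \<in> I" for k
      using * by (simp add: letter_diag_def)
    then show "cong_block (W (g(i := g i \<otimes>\<^bsub>U\<^esub> A))) (W g)"
      using gU AU I_zero by (intro word_cong) (auto simp: mult_unitri_superdiag)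
  qed
next
  assume R: ?R
  have vars: "Inl 1 \<in> word_vars (outer_comm_word c1 c2)" "Inl 2 \<in> word_vars (outer_comm_word c1 c2)"
    using c1 by (auto simp: word_vars_outer_comm_word)
  have one: "\<one>\<^bsub>U\<^esub> \<in> HC" using H.one_closed by simp
  have AU: "A \<in> carrier U" using A by (rule HC_U)
  have part_one: "a_part \<one>\<^bsub>U\<^esub> = 0" "b_part \<one>\<^bsub>U\<^esub> = 0"
    by (simp_all add: a_part_def b_part_def one_unitri)
  have part_lm: "a_part (letter_matrix w p q) = p" "b_part (letter_matrix w p q) = q" for p q
    using w_a w(1) by (simp_all add: a_part_def b_part_def letter_matrix_def letter_diag_def)
  have U: "letter_assignment C D \<in> UNIV \<rightarrow> carrier U" if "C \<in> HC" "D \<in> HC" for C D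
    using letter_assignment_closed[OF that] HC_U by (auto simp: Pi_iff)
  let ?a = "letter_matrix w 1 0" and ?b = "letter_matrix w 0 1"
  have ab: "?a \<in> HC" "?b \<in> HC" using letter_matrix_HC B_a B_b by auto
  \<comment> \<open>Against \<open>?a\<close> in the slot of x_2 the determinant is
    \<open>b_part A\<close>, and it is 0 for the identity in place of \<open>A\<close>.\<close>
  have "(letter_assignment \<one>\<^bsub>U\<^esub> ?a)(Inl 1 := letter_assignment \<one>\<^bsub>U\<^esub> ?a (Inl 1) \<otimes>\<^bsub>U\<^esub> A) =
      letter_assignment A ?a"
    using AU by (auto simp: fun_eq_iff letter_assignment_def split: sum.split)
  then have "cong_block (W (letter_assignment A ?a)) (W (letter_assignment \<one>\<^bsub>U\<^esub> ?a))"
    using R vars(1) letter_assignment_closed[OF one ab(1)] by (metis (no_types, lifting))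
  then have "W (letter_assignment A ?a) 0 (c1 + c2 + 2) -
      W (letter_assignment \<one>\<^bsub>U\<^esub> ?a) 0 (c1 + c2 + 2) \<in> I"
    using cong_block_word U A ab one by blast
  then have b: "b_part A \<in> I"
    using word_letter_assignment[OF A ab(1) refl] word_letter_assignment[OF one ab(1) refl] I_minus
    by (fastforce simp: part_one part_lm)
  \<comment> \<open>Against \<open>?b\<close> in the slot of x_1 the determinant is
    \<open>a_part A\<close>.\<close>
  have "(letter_assignment ?b \<one>\<^bsub>U\<^esub>)(Inl 2 := letter_assignment ?b \<one>\<^bsub>U\<^esub> (Inl 2) \<otimes>\<^bsub>U\<^esub> A) =
      letter_assignment ?b A"
    using AU by (auto simp: fun_eq_iff letter_assignment_def split: sum.split)
  then have "cong_block (W (letter_assignment ?b A)) (W (letter_assignment ?b \<one>\<^bsub>U\<^esub>))"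
    using R vars(2) letter_assignment_closed[OF ab(2) one] by (metis (no_types, lifting))
  then have "W (letter_assignment ?b A) 0 (c1 + c2 + 2) -
      W (letter_assignment ?b \<one>\<^bsub>U\<^esub>) 0 (c1 + c2 + 2) \<in> I"
    using cong_block_word U A ab one by blast
  then have "a_part A \<in> I"
    using word_letter_assignment[OF ab(2) A refl] word_letter_assignment[OF ab(2) one refl] I_minus
    by (fastforce simp: part_one part_lm)
  with b show "a_part A \<in> I \<and> b_part A \<in> I" by blast
qed

text \<open>Via \<open>\<psi>\<close>, the group \<open>G\<close> is \<open>B\<close> modulo the
  pairs with both entries in \<open>I\<close>. The injection \<open>code\<close> supplies the
  countability needed to realise the quotient on \<open>'e\<close>.\<close>

lemma capable:
  fixes G :: "'g monoid" and code :: "'r \<Rightarrow> 'c :: countable"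
  assumes "group G" and inf: "infinite (UNIV :: 'e set)" and code: "inj code"
    and \<psi>: "\<And>p q. (p, q) \<in> B \<Longrightarrow> \<psi> p q \<in> carrier G"
      "\<And>p q p' q'. (p, q) \<in> B \<Longrightarrow> (p', q') \<in> B \<Longrightarrow> \<psi> (p + p') (q + q') = \<psi> p q \<otimes>\<^bsub>G\<^esub> \<psi> p' q'"
      "\<And>x. x \<in> carrier G \<Longrightarrow> \<exists>p q. (p, q) \<in> B \<and> \<psi> p q = x"
      "\<And>p q. (p, q) \<in> B \<Longrightarrow> \<psi> p q = \<one>\<^bsub>G\<^esub> \<longleftrightarrow> p \<in> I \<and> q \<in> I"
  shows "varietal_capable TYPE('e) {outer_comm_word c1 c2} G"
proof (rule varietal_capableI[OF K_normal inf])
  define n where "n = c1 + c2 + 3"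
  \<comment> \<open>The entries of the finite block determine the coset modulo
    \<open>K\<close>.\<close>
  let ?e = "\<lambda>A. map (\<lambda>i. map (\<lambda>j. code (A i j)) [0..<n]) [0..<n]"
  show "A \<otimes>\<^bsub>H\<^esub> inv\<^bsub>H\<^esub> A' \<in> K"
    if A: "A \<in> carrier H" "A' \<in> carrier H" and eq: "?e A = ?e A'" for A A'
  proof -
    have "A i j = A' i j" if "j < n" for i j
    proof (cases "i \<le> j")
      case True
      with that have "i \<in> {0..<n}" "j \<in> {0..<n}" by auto
      with eq have "code (A i j) = code (A' i j)" by simp
      then show ?thesis by (rule injD[OF code])
    next
      case False
      then show ?thesis using A HC_U unitri_below[of A j i] unitri_below[of A' j i] by simp
    qed
    then have "cong_block A A'" by (simp add: cong_block_def n_def I_zero)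
    then show ?thesis using A mult_inv_in_K by simp
  qed
  let ?\<psi> = "\<lambda>A. \<psi> (a_part A) (b_part A)"
  show "group G" by fact
  show "?\<psi> \<in> hom H G"
    by (auto simp: hom_def HC_iff parts_mult \<psi>)
  show "?\<psi> ` carrier H = carrier G"
  proof
    show "carrier G \<subseteq> ?\<psi> ` carrier H"
    proof
      fix x assume "x \<in> carrier G"
      then obtain p q where pq: "(p, q) \<in> B" "\<psi> p q = x" using \<psi>(3) by blast
      then have "?\<psi> (letter_matrix w p q) = x"
        using w_a w(1) by (simp add: a_part_def b_part_def letter_matrix_def letter_diag_def)
      then show "x \<in> ?\<psi> ` carrier H"
        using letter_matrix_HC[OF pq(1)] by (intro image_eqI) auto
    qed
  qed (auto simp: HC_iff \<psi>)
  fix A assume A: "A \<in> carrier H"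
  have "?\<psi> A = \<one>\<^bsub>G\<^esub> \<longleftrightarrow> a_part A \<in> I \<and> b_part A \<in> I"
    using A \<psi>(4) by (simp add: HC_iff)
  also have "\<dots> \<longleftrightarrow> (\<forall>g \<in> UNIV \<rightarrow> HC. \<forall>i \<in> word_vars (outer_comm_word c1 c2).
       cong_block (W (g(i := g i \<otimes>\<^bsub>U\<^esub> A))) (W g))"
    using A by (intro parts_in_I_iff) simp
  also have "\<dots> \<longleftrightarrow> (\<forall>g \<in> UNIV \<rightarrow> HC. \<forall>i \<in> word_vars (outer_comm_word c1 c2).
      word_val H (g(i := g i \<otimes>\<^bsub>H\<^esub> A)) (outer_comm_word c1 c2) \<otimes>\<^bsub>H\<^esub>
        inv\<^bsub>H\<^esub> word_val H g (outer_comm_word c1 c2) \<in> K)"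
  proof (intro ball_cong refl)
    fix g :: "nat + nat \<Rightarrow> nat \<Rightarrow> nat \<Rightarrow> 'r" and i
    assume g: "g \<in> UNIV \<rightarrow> HC"
    have g': "g(i := g i \<otimes>\<^bsub>U\<^esub> A) \<in> UNIV \<rightarrow> HC"
      using g A H.m_closed[of "g i" A] by (auto simp: Pi_iff)
    have wH: "word_val H h v \<in> HC" "word_val H h v = word_val U h v"
      if "h \<in> UNIV \<rightarrow> HC" for h and v :: "(nat + nat) group_word"
      using H.word_val_closed[of h v] that U.word_val_subgroup[OF subgroup_HC that] by simp_all
    show "cong_block (W (g(i := g i \<otimes>\<^bsub>U\<^esub> A))) (W g) \<longleftrightarrow>
        word_val H (g(i := g i \<otimes>\<^bsub>H\<^esub> A)) (outer_comm_word c1 c2) \<otimes>\<^bsub>H\<^esub>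
          inv\<^bsub>H\<^esub> word_val H g (outer_comm_word c1 c2) \<in> K"
      using mult_inv_in_K[OF wH(1)[OF g'] wH(1)[OF g]] wH(2)[OF g'] wH(2)[OF g] by simp
  qed
  finally show "?\<psi> A = \<one>\<^bsub>G\<^esub> \<longleftrightarrow> (\<forall>v\<in>{outer_comm_word c1 c2}. \<forall>g\<in>UNIV \<rightarrow> carrier H. \<forall>i\<in>word_vars v.
      word_val H (g(i := g i \<otimes>\<^bsub>H\<^esub> A)) v \<otimes>\<^bsub>H\<^esub> inv\<^bsub>H\<^esub> word_val H g v \<in> K)"
    by simp
qed

end

section \<open>Sums of cyclic groups\<close>

lemma varietal_capable_iso:
  assumes "G \<cong> H" "varietal_capable TYPE('e) V H"
  shows "varietal_capable TYPE('e) V G"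
  using assms iso_trans unfolding varietal_capable_def by blast

abbreviation cyclic_sum :: "nat \<Rightarrow> (nat \<Rightarrow> nat) \<Rightarrow> (nat \<Rightarrow> int) monoid" where
  "cyclic_sum t n \<equiv> sum_group {1..t} (\<lambda>i. integer_mod_group (n i))"

lemma carrier_cyclic_sum:
  "carrier (cyclic_sum t n) = (\<Pi>\<^sub>E i\<in>{1..t}. carrier (integer_mod_group (n i)))"
  by (subst carrier_sum_group) auto

lemma mod_in_integer_mod_group [simp]: "x mod int m \<in> carrier (integer_mod_group m)"
  by (simp add: carrier_integer_mod_group)

lemma integer_mod_group_mod:
  "x \<in> carrier (integer_mod_group m) \<Longrightarrow> x mod int m = x"
  by (cases "m = 0") (auto simp: carrier_integer_mod_group)

lemma comm_group_cyclic_sum: "comm_group (cyclic_sum t n)"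
proof -
  interpret group "cyclic_sum t n" by (rule sum_group) simp
  show ?thesis by (rule group_comm_groupI) (auto simp: add.commute)
qed

lemma pow_cyclic_sum:
  assumes "x \<in> carrier (cyclic_sum t n)"
  shows "x [^]\<^bsub>cyclic_sum t n\<^esub> (k :: nat) = (\<lambda>i\<in>{1..t}. (int k * x i) mod int (n i))"
proof -
  interpret group "cyclic_sum t n" by (rule sum_group) simp
  show ?thesis
  proof (induction k)
    case (Suc k)
    show ?case
      unfolding nat_pow_Suc Suc
      by (auto simp: fun_eq_iff restrict_def mod_simps algebra_simps)
  qed (simp add: restrict_def)
qed

lemma chain_dvd:
  fixes n :: "nat \<Rightarrow> nat"
  assumes "\<And>i. 1 \<le> i \<Longrightarrow> i < t \<Longrightarrow> n (i + 1) dvd n i" "1 \<le> i" "i \<le> j" "j \<le> t"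
  shows "n j dvd n i"
  using assms(3,4)
proof (induction j rule: dec_induct)
  case (step j)
  then have "n (j + 1) dvd n j" using assms(1,2) by simp
  then show ?case using step by (auto intro: dvd_trans)
qed simp

text \<open>\<open>integer_mod_group 0\<close> is the group of integers, so n 1 = 0 would make the
  first summand infinite.\<close>

lemma cyclic_sum_finite_pos:
  assumes fin: "finite (carrier (cyclic_sum t n))" and t: "1 \<le> t"
  shows "0 < n 1"
proof (rule ccontr)
  assume "\<not> 0 < n 1"
  then have n: "n 1 = 0" by simp
  let ?f = "\<lambda>z :: int. \<lambda>i\<in>{1..t}. if i = 1 then z else 0"
  have "inj ?f"
  proof (rule injI)
    fix z z' assume "?f z = ?f z'"
    from fun_cong[OF this, of 1] show "z = z'" using t by simp
  qed
  moreover have "range ?f \<subseteq> carrier (cyclic_sum t n)"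
    using n by (auto simp: carrier_cyclic_sum carrier_integer_mod_group simp del: One_nat_def)
  ultimately show False
    using fin finite_imageD finite_subset infinite_UNIV_int by blast
qed

section \<open>Necessity for sums of cyclic groups\<close>

lemma cyclic_sum_capableD:
  assumes cap: "varietal_capable TYPE('e) {outer_comm_word c1 c2} (cyclic_sum t n)"
    and c: "c2 \<le> c1" "1 \<le> c1"
    and fin: "finite (carrier (cyclic_sum t n))"
    and dvd: "\<And>i. 1 \<le> i \<Longrightarrow> i < t \<Longrightarrow> n (i + 1) dvd n i"
    and nontriv: "\<not> (t \<le> 1 \<and> order (cyclic_sum t n) = 1)"
  shows "2 \<le> t \<and> n 1 = n 2"
proof -
  let ?G = "cyclic_sum t n"
  interpret G: comm_group ?G by (rule comm_group_cyclic_sum)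
  \<comment> \<open>A generator of the first summand; the reduction covers n 1 = 1, where it is
    0.\<close>
  define b where "b = (\<lambda>i\<in>{1..t}. if i = 1 then 1 mod int (n 1) else 0)"
  \<comment> \<open>By the divisibility chain, n 2 annihilates every summand but the first. With at
    most one summand the group is cyclic and exponent 1 works; it then turns out to be
    trivial.\<close>
  define m where "m = (if t \<le> 1 then 1 else n 2)"
  have b: "b \<in> carrier ?G" by (auto simp: carrier_cyclic_sum b_def simp del: One_nat_def)
  have pow: "\<exists>k :: nat. x [^]\<^bsub>?G\<^esub> m = b [^]\<^bsub>?G\<^esub> (k * m)" if x: "x \<in> carrier ?G" for x
  proof
    \<comment> \<open>\<open>nat\<close> loses nothing: for t \<ge> 1 finiteness gives n 1 > 0,
      hence x 1 \<ge> 0.\<close>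
    show "x [^]\<^bsub>?G\<^esub> m = b [^]\<^bsub>?G\<^esub> (nat (x 1) * m)"
      unfolding pow_cyclic_sum[OF x] pow_cyclic_sum[OF b]
    proof (rule restrict_ext)
      fix i assume i: "i \<in> {1..t}"
      show "int m * x i mod int (n i) = int (nat (x 1) * m) * b i mod int (n i)"
      proof (cases "i = 1")
        case True
        have "x 1 \<in> carrier (integer_mod_group (n 1))" "0 < n 1"
          using x i fin cyclic_sum_finite_pos by (auto simp: carrier_cyclic_sum simp del: One_nat_def)
        then have "0 \<le> x 1" by (simp add: carrier_integer_mod_group)
        then show ?thesis using True i by (simp add: b_def mod_simps mult.commute)
      next
        case False
        then have "n i dvd m" using i chain_dvd[of t n 2 i, OF dvd] by (auto simp: m_def)
        then show ?thesis using False i by (simp add: b_def)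
      qed
    qed
  qed
  have bm: "b [^]\<^bsub>?G\<^esub> m = \<one>\<^bsub>?G\<^esub>"
    by (rule capable_pow_eq_one[OF cap comm_group_cyclic_sum c b pow])
  show ?thesis
  proof (cases "t \<le> 1")
    case True
    have "x = \<one>\<^bsub>?G\<^esub>" if x: "x \<in> carrier ?G" for x
    proof -
      obtain k :: nat where "x [^]\<^bsub>?G\<^esub> m = b [^]\<^bsub>?G\<^esub> (k * m)" using pow[OF x] by blast
      also have "\<dots> = (b [^]\<^bsub>?G\<^esub> m) [^]\<^bsub>?G\<^esub> k"
        using G.nat_pow_pow[OF b, of m k] by (simp only: mult.commute)
      finally have "x [^]\<^bsub>?G\<^esub> m = \<one>\<^bsub>?G\<^esub>"
        unfolding bm by (simp only: G.nat_pow_one)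
      then show ?thesis using True x by (simp only: m_def if_True G.nat_pow_eone)
    qed
    then have "carrier ?G = {\<one>\<^bsub>?G\<^esub>}" using G.one_closed by blast
    then have "order ?G = 1" unfolding order_def by simp
    then show ?thesis using nontriv True by simp
  next
    case False
    have "(b [^]\<^bsub>?G\<^esub> m) 1 = 0" unfolding bm using False by simp
    then have "int (n 2) * (1 mod int (n 1)) mod int (n 1) = 0"
      unfolding pow_cyclic_sum[OF b] using False by (simp add: b_def m_def)
    then have "n 1 dvd n 2" by (simp add: mod_simps mod_eq_0_iff_dvd)
    moreover have "n 2 dvd n 1" using dvd[of 1] False by (simp add: numeral_2_eq_2)
    ultimately show ?thesis using False by (simp add: dvd_antisym)
  qed
qed

section \<open>Sufficiency for sums of cyclic groups\<close>

text \<open>The ideal \<open>I\<close> below has \<open>\<int>[X]/I \<cong> \<int>\<^sub>n\<^sub>2 \<oplus> \<dots> \<oplus> \<int>\<^sub>n\<^sub>t\<close>; it is closed under multiplication by \<open>X\<close>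
  because of the divisibility chain. The letter \<open>b\<close> takes coefficients in \<open>\<int>[X]\<close> and \<open>a\<close> in \<open>\<int>\<close>,
  where \<open>I \<inter> \<int> = n\<^sub>2 \<int> = n\<^sub>1 \<int>\<close>.\<close>

lemma cyclic_sum_capableI:
  assumes c: "1 \<le> c2" "c2 < c1 \<or> (c1 = c2 \<and> 1 < c1)"
    and dvd: "\<And>i. 1 \<le> i \<Longrightarrow> i < t \<Longrightarrow> n (i + 1) dvd n i"
    and t: "2 \<le> t" and n: "n 1 = n 2"
    and inf: "infinite (UNIV :: 'e set)"
  shows "varietal_capable TYPE('e) {outer_comm_word c1 c2} (cyclic_sum t n)"
proof -
  let ?G = "cyclic_sum t n"
  \<comment> \<open>Coefficient i stands for component i + 2, since component 1 belongs to the
    letter a.\<close>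
  define I :: "int poly set" where "I = {f. \<forall>i. i + 2 \<le> t \<longrightarrow> int (n (i + 2)) dvd poly.coeff f i}"
  define B :: "(int poly \<times> int poly) set" where "B = {([:p:], q) | p q. True}"
  have B: "(f, q) \<in> B \<longleftrightarrow> (\<exists>p. f = [:p:])" for f q by (auto simp: B_def)
  obtain w y j where wy: "nil_lead (\<lambda>i. letter_diag w (if y i then 0 else 1) (if y i then 1 else 0)) c2 0
      \<in> {1, - 1 :: int poly}"
    "w 0" "0 < j" "j \<le> c1" "w j" "w (c2 + 1)" "\<And>m. m \<in> {1..c1} \<Longrightarrow> \<not> w (c2 + 1 + m)"
    by (rule exists_letter_pattern[OF c]) blast
  have I_mult: "r * f \<in> I" if "f \<in> I" for r f
  proof -
    \<comment> \<open>Coefficient i - k of \<open>f\<close> is divisible by n (i - k + 2), which is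
      a multiple of n (i + 2).\<close>
    have "int (n (i + 2)) dvd poly.coeff r k * poly.coeff f (i - k)" if "i + 2 \<le> t" "k \<le> i" for i k
    proof -
      have "n (i + 2) dvd n (i - k + 2)" using that by (intro chain_dvd[of t n, OF dvd]) auto
      moreover have "int (n (i - k + 2)) dvd poly.coeff f (i - k)" using \<open>f \<in> I\<close> that by (simp add: I_def)
      ultimately show ?thesis by (meson dvd_mult dvd_trans of_nat_dvd_iff)
    qed
    then show ?thesis unfolding I_def by (auto simp: Polynomial.coeff_mult intro!: dvd_sum)
  qed
  interpret L: letter_group w B I c1 c2 y j
  proof unfold_locales
    show "1 \<le> c1" using c by auto
    show "(p - p', q - q') \<in> B" if "(p, q) \<in> B" "(p', q') \<in> B" for p q p' q'
      using that by (auto simp: B)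
    show "(1, 0) \<in> B" "(0, 1) \<in> B"
      unfolding B by (metis one_pCons, metis pCons_0_0)
  qed (use wy I_mult in \<open>auto simp: I_def\<close>)
  define \<psi> where "\<psi> f q = (\<lambda>i\<in>{1..t}. (if i = 1 then poly.coeff f 0 else poly.coeff q (i - 2)) mod int (n i))"
    for f q :: "int poly"
  show ?thesis
  proof (rule L.capable[where code = coeffs and \<psi> = \<psi>])
    show "group ?G" by (rule sum_group) simp
    show "inj (coeffs :: int poly \<Rightarrow> int list)" by (simp add: inj_def coeffs_eq_iff)
    show "\<psi> f q \<in> carrier ?G" for f q
      by (auto simp: \<psi>_def carrier_cyclic_sum simp del: One_nat_def)
    show "\<psi> (f + f') (q + q') = \<psi> f q \<otimes>\<^bsub>?G\<^esub> \<psi> f' q'" for f q f' q'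
      by (auto simp: \<psi>_def fun_eq_iff mod_simps)
    show "\<exists>f q. (f, q) \<in> B \<and> \<psi> f q = x" if x: "x \<in> carrier ?G" for x
    proof (intro exI conjI)
      show "([:x 1:], Poly (map (\<lambda>i. x (i + 2)) [0..<t - 1])) \<in> B" by (simp add: B)
      show "\<psi> [:x 1:] (Poly (map (\<lambda>i. x (i + 2)) [0..<t - 1])) = x"
      proof
        fix i
        show "\<psi> [:x 1:] (Poly (map (\<lambda>i. x (i + 2)) [0..<t - 1])) i = x i"
        proof (cases "i \<in> {1..t}")
          case True
          then have xi: "x i mod int (n i) = x i"
            using x by (intro integer_mod_group_mod) (auto simp: carrier_cyclic_sum simp del: One_nat_def)
          show ?thesis
          proof (cases "i = 1")
            case False
            then have "i - 2 < t - 1" "i - 2 + 2 = i" using True by auto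
            then show ?thesis using True False xi
              by (simp add: \<psi>_def coeff_Poly_eq nth_default_nth)
          qed (use True xi in \<open>simp add: \<psi>_def\<close>)
        next
          case False
          then have "x i = undefined"
            using x unfolding carrier_cyclic_sum by (intro PiE_arb)
          then show ?thesis by (simp only: \<psi>_def restrict_apply False if_False)
        qed
      qed
    qed
    show "\<psi> f q = \<one>\<^bsub>?G\<^esub> \<longleftrightarrow> f \<in> I \<and> q \<in> I" if fq: "(f, q) \<in> B" for f q
    proof -
      obtain p where f: "f = [:p:]" using fq B by blast
      \<comment> \<open>For a constant polynomial only coefficient 0 counts, and its modulus is n 2
        = n 1.\<close>
      have "f \<in> I \<longleftrightarrow> int (n 1) dvd poly.coeff f 0"
        unfolding I_def f using t n by (auto simp: coeff_pCons numeral_2_eq_2 split: nat.splits)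
      moreover have "\<psi> f q = \<one>\<^bsub>?G\<^esub> \<longleftrightarrow>
          (\<forall>i\<in>{1..t}. int (n i) dvd (if i = 1 then poly.coeff f 0 else poly.coeff q (i - 2)))"
      proof -
        have "restrict u {1..t} = restrict v {1..t} \<longleftrightarrow> (\<forall>i\<in>{1..t}. u i = v i)" for u v :: "nat \<Rightarrow> int"
          by (metis restrict_apply' restrict_ext)
        then show ?thesis
          by (simp only: \<psi>_def one_sum_group one_integer_mod_group mod_eq_0_iff_dvd)
      qed
      moreover have "\<dots> \<longleftrightarrow> int (n 1) dvd poly.coeff f 0 \<and>
          (\<forall>i\<in>{2..t}. int (n i) dvd poly.coeff q (i - 2))"
      proof -
        have "{1..t} = insert 1 {2..t}" using t by auto
        then show ?thesis by auto
      qed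
      moreover have "(\<forall>i\<in>{2..t}. int (n i) dvd poly.coeff q (i - 2)) \<longleftrightarrow> q \<in> I"
      proof
        assume *: "\<forall>i\<in>{2..t}. int (n i) dvd poly.coeff q (i - 2)"
        show "q \<in> I"
          unfolding I_def
        proof (intro CollectI allI impI)
          fix i assume "i + 2 \<le> t"
          then show "int (n (i + 2)) dvd poly.coeff q i" using bspec[OF *, of "i + 2"] by simp
        qed
      next
        assume "q \<in> I"
        then have *: "i - 2 + 2 \<le> t \<Longrightarrow> int (n (i - 2 + 2)) dvd poly.coeff q (i - 2)" for i
          unfolding I_def by blast
        show "\<forall>i\<in>{2..t}. int (n i) dvd poly.coeff q (i - 2)"
        proof
          fix i assume i: "i \<in> {2..t}"
          then have "i - 2 + 2 = i" by (intro le_add_diff_inverse2) simp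
          with *[of i] i show "int (n i) dvd poly.coeff q (i - 2)" by (metis atLeastAtMost_iff)
        qed
      qed
      ultimately show ?thesis by blast
    qed
  qed (rule inf)
qed

theorem theorem3p4:
  fixes c1 c2 t :: nat and n :: "nat \<Rightarrow> nat" and G :: "'g monoid"
  assumes "c1 \<ge> 1" and "c2 \<ge> 1"
    and "(c2 < c1 \<and> c1 \<le> 2 * c2) \<or> (c1 = c2 \<and> c1 > 1)"
    and "comm_group G" and "finite (carrier G)"
    and "G \<cong> sum_group {1..t} (\<lambda>i. integer_mod_group (n i))"
    and "\<And>i. 1 \<le> i \<Longrightarrow> i < t \<Longrightarrow> n (i + 1) dvd n i"
    and "\<not> (t \<le> 1 \<and> order G = 1)"
    and "infinite (UNIV :: 'e set)"
  shows "varietal_capable TYPE('e) {outer_comm_word c1 c2} G \<longleftrightarrow> t \<ge> 2 \<and> n 1 = n 2"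
proof
  interpret comm_group G by fact
  have iso: "cyclic_sum t n \<cong> G" using iso_sym assms(6) by blast
  obtain \<phi> where "bij_betw \<phi> (carrier G) (carrier (cyclic_sum t n))"
    using assms(6) by (auto simp: is_iso_def iso_def)
  then have card: "finite (carrier (cyclic_sum t n))" "order (cyclic_sum t n) = order G"
    using assms(5) bij_betw_finite bij_betw_same_card unfolding order_def by metis+
  assume "varietal_capable TYPE('e) {outer_comm_word c1 c2} G"
  then have "varietal_capable TYPE('e) {outer_comm_word c1 c2} (cyclic_sum t n)"
    by (rule varietal_capable_iso[OF iso])
  from cyclic_sum_capableD[OF this _ assms(1) card(1) assms(7)] show "t \<ge> 2 \<and> n 1 = n 2"
    using assms(3,8) card(2) by auto
next
  assume "t \<ge> 2 \<and> n 1 = n 2"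
  then show "varietal_capable TYPE('e) {outer_comm_word c1 c2} G"
    using assms by (intro varietal_capable_iso[OF assms(6)] cyclic_sum_capableI) auto
qed

end
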